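(* Let $\Bbbk$ be a field of characteristic zero, let $V$ be a $\Bbbk$-vector space of finite positive dimension $\ell$, and let $S$ be the graded algebra of polynomial functions on $V$. Let $\mathcal{A}$ be a central hyperplane arrangement in $V$. If $\mathcal{A}$ is free, then the algebra $\mathrm{Diff}(\mathcal{A})$ of differential operators tangent to $\mathcal{A}$ is generated, as a $\Bbbk$-algebra, by its subset $S\cup\mathrm{Der}(\mathcal{A})$.
   Context: $S$ is the symmetric algebra on $V^*$ (a polynomial ring in $\ell$ variables over $\Bbbk$) with its usual grading. A central hyperplane arrangement $\mathcal{A}=\{H_1,\dots,H_r\}$ in $V$ is a finite set of (pairwise distinct) linear subspaces of codimension 1. For each $i\in\{1,\dots,r\}$ choose $\alpha_i\in V^*$ with $H_i=\ker\alpha_i$, and let $Q=\alpha_1\cdots\alpha_r\in S$ be the defining polynomial (unique up to a non-zero scalar). $\mathrm{Der}(S)$ is the graded left $S$-module of $\Bbbk$-linear derivations of $S$, and $\mathrm{Der}(\mathcal{A})=\{\delta\in\mathrm{Der}(S):\delta(QS)\subseteq QS\}$. The arrangement is free if $\mathrm{Der}(\mathcal{A})$ is a free graded $S$-module. $\mathrm{Diff}(S)\subseteq\mathrm{End}_{\Bbbk}(S)$ is the algebra of all regular ($\Bbbk$-linear, Grothendieck) differential operators on $S$; $S$ is viewed as a subalgebra of it, with $f\in S$ acting by multiplication. For a right ideal $I$ of $\mathrm{Diff}(S)$, its idealizer is $\mathbb{I}(I)=\{u\in\mathrm{Diff}(S):uI\subseteq I\}$. The algebra of differential operators tangent to $\mathcal{A}$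 is $\mathrm{Diff}(\mathcal{A})=\bigcap_{t\geq1}\mathbb{I}(Q^t\,\mathrm{Diff}(S))$. It contains both $S$ and $\mathrm{Der}(\mathcal{A})$. *)

theory Defs
  imports Complex_Main "HOL-Library.Function_Algebras"
begin

text \<open>
  A vector space is a type \<open>'v\<close> with scalar multiplication \<open>scale\<close>. Functions \<open>'v \<Rightarrow> 'k\<close> carry the
  pointwise ring structure. Over an infinite field the symmetric algebra on the dual space is the
  ring of polynomial functions. As that ring is a set \<open>S\<close> of functions and not a type, a
  \<open>'k\<close>-linear endomorphism of it is represented by an operator on all functions that vanishes
  outside \<open>S\<close>. With this convention equality of operators is equality on \<open>S\<close>, and sums and
  composites of endomorphisms are ordinary pointwise sums and composites. The product of the
  algebra of endomorphisms is \<open>\<circ>\<close> (the pointwise \<open>*\<close> on operators is never used).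
\<close>

context
  fixes scale :: "'k::field \<Rightarrow> 'v::ab_group_add \<Rightarrow> 'v"
begin

abbreviation linear_forms :: "('v \<Rightarrow> 'k) set" where
  "linear_forms \<equiv> {\<alpha>. Vector_Spaces.linear scale (*) \<alpha>}"

inductive_set poly_functions :: "('v \<Rightarrow> 'k) set" where
  const: "(\<lambda>v. c) \<in> poly_functions"
| linear: "Vector_Spaces.linear scale (*) \<alpha> \<Longrightarrow> \<alpha> \<in> poly_functions"
| add: "f \<in> poly_functions \<Longrightarrow> g \<in> poly_functions \<Longrightarrow> f + g \<in> poly_functions"
| mult: "f \<in> poly_functions \<Longrightarrow> g \<in> poly_functions \<Longrightarrow> f * g \<in> poly_functions"

definition poly_part :: "int \<Rightarrow> ('v \<Rightarrow> 'k) set" where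
  "poly_part m = (if m < 0 then {0}
     else module.span (\<lambda>c f v. c * f v)
       {prod_list \<alpha>s | \<alpha>s. length \<alpha>s = nat m \<and> set \<alpha>s \<subseteq> linear_forms})"

definition poly_endos :: "(('v \<Rightarrow> 'k) \<Rightarrow> ('v \<Rightarrow> 'k)) set" where
  "poly_endos = {u.
     (\<forall>f. f \<notin> poly_functions \<longrightarrow> u f = 0) \<and>
     (\<forall>f\<in>poly_functions. u f \<in> poly_functions) \<and>
     (\<forall>f\<in>poly_functions. \<forall>g\<in>poly_functions. u (f + g) = u f + u g) \<and>
     (\<forall>c. \<forall>f\<in>poly_functions. u (\<lambda>v. c * f v) = (\<lambda>v. c * u f v))}"

definition mult_op :: "('v \<Rightarrow> 'k) \<Rightarrow> ('v \<Rightarrow> 'k) \<Rightarrow> ('v \<Rightarrow> 'k)" where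
  "mult_op f = (\<lambda>g. if g \<in> poly_functions then f * g else 0)"

definition commutator ::
    "(('v \<Rightarrow> 'k) \<Rightarrow> ('v \<Rightarrow> 'k)) \<Rightarrow> (('v \<Rightarrow> 'k) \<Rightarrow> ('v \<Rightarrow> 'k)) \<Rightarrow> ('v \<Rightarrow> 'k) \<Rightarrow> ('v \<Rightarrow> 'k)" where
  "commutator u w = (\<lambda>g. u (w g) - w (u g))"

primrec diff_ops_upto :: "nat \<Rightarrow> (('v \<Rightarrow> 'k) \<Rightarrow> ('v \<Rightarrow> 'k)) set" where
  "diff_ops_upto 0 =
     {u \<in> poly_endos. \<forall>f\<in>poly_functions. commutator u (mult_op f) = (\<lambda>g. 0)}"
| "diff_ops_upto (Suc p) =
     {u \<in> poly_endos. \<forall>f\<in>poly_functions. commutator u (mult_op f) \<in> diff_ops_upto p}"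

definition diff_ops :: "(('v \<Rightarrow> 'k) \<Rightarrow> ('v \<Rightarrow> 'k)) set" where
  "diff_ops = (\<Union>p. diff_ops_upto p)"

definition derivations :: "(('v \<Rightarrow> 'k) \<Rightarrow> ('v \<Rightarrow> 'k)) set" where
  "derivations = {\<delta> \<in> poly_endos.
     \<forall>f\<in>poly_functions. \<forall>g\<in>poly_functions. \<delta> (f * g) = f * \<delta> g + \<delta> f * g}"

definition homogeneous_op :: "int \<Rightarrow> (('v \<Rightarrow> 'k) \<Rightarrow> ('v \<Rightarrow> 'k)) \<Rightarrow> bool" where
  "homogeneous_op d u \<longleftrightarrow> (\<forall>m. \<forall>f\<in>poly_part m. u f \<in> poly_part (m + d))"

text \<open>Linear combinations with coefficients in \<open>S\<close> for the left \<open>S\<close>-module structure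
  \<open>f \<cdot> u = mult_op f \<circ> u\<close> on operators.\<close>

definition poly_combination ::
    "(('v \<Rightarrow> 'k) \<Rightarrow> ('v \<Rightarrow> 'k)) set \<Rightarrow> ((('v \<Rightarrow> 'k) \<Rightarrow> ('v \<Rightarrow> 'k)) \<Rightarrow> ('v \<Rightarrow> 'k))
       \<Rightarrow> ('v \<Rightarrow> 'k) \<Rightarrow> ('v \<Rightarrow> 'k)" where
  "poly_combination F c = (\<lambda>g. \<Sum>b\<in>F. mult_op (c b) (b g))"

definition poly_basis ::
    "(('v \<Rightarrow> 'k) \<Rightarrow> ('v \<Rightarrow> 'k)) set \<Rightarrow> (('v \<Rightarrow> 'k) \<Rightarrow> ('v \<Rightarrow> 'k)) set \<Rightarrow> bool" where
  "poly_basis M B \<longleftrightarrow> B \<subseteq> M \<and>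
     (\<forall>u\<in>M. \<exists>F c. finite F \<and> F \<subseteq> B \<and> c ` F \<subseteq> poly_functions \<and> u = poly_combination F c) \<and>
     (\<forall>F c. finite F \<longrightarrow> F \<subseteq> B \<longrightarrow> c ` F \<subseteq> poly_functions \<longrightarrow>
        poly_combination F c = (\<lambda>g. 0) \<longrightarrow> (\<forall>b\<in>F. c b = 0))"

definition free_graded :: "(('v \<Rightarrow> 'k) \<Rightarrow> ('v \<Rightarrow> 'k)) set \<Rightarrow> bool" where
  "free_graded M \<longleftrightarrow> (\<exists>B. poly_basis M B \<and> (\<forall>b\<in>B. \<exists>d. homogeneous_op d b))"

definition central_arrangement :: "'v set set \<Rightarrow> bool" where
  "central_arrangement \<A> \<longleftrightarrow> finite \<A> \<and>
     (\<forall>H\<in>\<A>. module.subspace scale H \<and>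
        vector_space.dim scale H + 1 = vector_space.dim scale (UNIV :: 'v set))"

definition defining_polynomial :: "'v set set \<Rightarrow> ('v \<Rightarrow> 'k) \<Rightarrow> bool" where
  "defining_polynomial \<A> Q \<longleftrightarrow>
     (\<exists>\<alpha>. (\<forall>H\<in>\<A>. \<alpha> H \<in> linear_forms \<and> {v. \<alpha> H v = 0} = H) \<and> Q = (\<Prod>H\<in>\<A>. \<alpha> H))"

definition tangent_derivations :: "('v \<Rightarrow> 'k) \<Rightarrow> (('v \<Rightarrow> 'k) \<Rightarrow> ('v \<Rightarrow> 'k)) set" where
  "tangent_derivations Q = {\<delta> \<in> derivations.
     \<delta> ` {Q * f | f. f \<in> poly_functions} \<subseteq> {Q * f | f. f \<in> poly_functions}}"

definition free_arrangement :: "'v set set \<Rightarrow> bool" where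
  "free_arrangement \<A> \<longleftrightarrow>
     (\<exists>Q. defining_polynomial \<A> Q \<and> free_graded (tangent_derivations Q))"

definition idealizer ::
    "(('v \<Rightarrow> 'k) \<Rightarrow> ('v \<Rightarrow> 'k)) set \<Rightarrow> (('v \<Rightarrow> 'k) \<Rightarrow> ('v \<Rightarrow> 'k)) set" where
  "idealizer I = {u \<in> diff_ops. \<forall>w\<in>I. u \<circ> w \<in> I}"

definition tangent_diff_ops :: "('v \<Rightarrow> 'k) \<Rightarrow> (('v \<Rightarrow> 'k) \<Rightarrow> ('v \<Rightarrow> 'k)) set" where
  "tangent_diff_ops Q =
     (\<Inter>t\<in>{1::nat..}. idealizer {mult_op (Q ^ t) \<circ> w | w. w \<in> diff_ops})"

text \<open>The unital \<open>'k\<close>-subalgebra of the algebra of endomorphisms of \<open>S\<close> generated by \<open>X\<close>.\<close>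

inductive_set generated_algebra ::
    "(('v \<Rightarrow> 'k) \<Rightarrow> ('v \<Rightarrow> 'k)) set \<Rightarrow> (('v \<Rightarrow> 'k) \<Rightarrow> ('v \<Rightarrow> 'k)) set"
  for X :: "(('v \<Rightarrow> 'k) \<Rightarrow> ('v \<Rightarrow> 'k)) set" where
  scalar: "mult_op (\<lambda>v. c) \<in> generated_algebra X"
| generator: "u \<in> X \<Longrightarrow> u \<in> generated_algebra X"
| add: "u \<in> generated_algebra X \<Longrightarrow> w \<in> generated_algebra X \<Longrightarrow> u + w \<in> generated_algebra X"
| comp: "u \<in> generated_algebra X \<Longrightarrow> w \<in> generated_algebra X \<Longrightarrow> u \<circ> w \<in> generated_algebra X"

end

end

theory Submission
  imports Defs "HOL-Computational_Algebra.Polynomial" "HOL-Library.Multiset"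
begin

text \<open>
  Let \<open>B\<close> be a basis of the module of tangent derivations. Since \<open>Q \<partial>\<^sub>i\<close> is tangent, every differential
  operator \<open>u\<close> becomes, after multiplication by a power \<open>a\<close> of \<open>Q\<close>, a combination over \<open>S\<close> of words
  in \<open>B\<close>. It remains to show that if \<open>u\<close> is tangent, all coefficients of \<open>a u\<close> are divisible by \<open>a\<close>. Let
  \<open>\<Phi>\<close> be the symbol of \<open>a u\<close>, a homogeneous polynomial in commuting variables \<open>y\<^sub>b\<close>, \<open>b \<in> B\<close>. The
  commutator of \<open>u\<close> with \<open>f \<in> S\<close> is tangent, and so is \<open>Q\<^sup>-\<^sup>1 u Q - u = Q\<^sup>-\<^sup>1 [u, Q]\<close>. Both have smaller
  order, and after multiplication by \<open>a\<close> their symbols are \<open>\<Sum>\<^sub>b (\<partial>\<Phi>/\<partial>y\<^sub>b) b(f)\<close> and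
  \<open>\<Sum>\<^sub>b (\<partial>\<Phi>/\<partial>y\<^sub>b) b(Q)/Q\<close>; by induction on the order both are divisible by \<open>a\<close>. So if \<open>s\<^sub>b\<close> denotes the
  coefficient of a fixed monomial in \<open>\<partial>\<Phi>/\<partial>y\<^sub>b\<close>, then \<open>\<Sum>\<^sub>b s\<^sub>b b\<close> is \<open>a\<close> times a derivation which is again
  tangent. As \<open>B\<close> is a basis, \<open>a\<close> divides every \<open>s\<^sub>b\<close>, hence \<open>\<Phi>\<close> since the characteristic is zero.
\<close>

lemma sum_fun_apply: "(\<Sum>i\<in>A. f i) x = (\<Sum>i\<in>A. f i x)"
  for f :: "'i \<Rightarrow> 'a \<Rightarrow> 'b::comm_monoid_add"
  by (induction A rule: infinite_finite_induct) auto

text \<open>With operators, which are functions with functions as values, these rules and \<open>o_apply\<close> make the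
  simplifier leave the ring operations for \<open>\<lambda>\<close>-terms.\<close>

declare plus_fun_apply [simp del] zero_fun_apply [simp del] times_fun_apply [simp del]
  one_fun_apply [simp del] uminus_apply [simp del] minus_apply [simp del] of_nat_fun_apply [simp del]
  o_apply [simp del]

lemmas fun_apply = plus_fun_apply zero_fun_apply times_fun_apply one_fun_apply uminus_apply
  minus_apply of_nat_fun_apply

section \<open>The integral domain of polynomial functions\<close>

locale polynomial_operators = finite_dimensional_vector_space scale Basis
  for scale :: "'k::field_char_0 \<Rightarrow> 'v::ab_group_add \<Rightarrow> 'v" and Basis :: "'v set"
begin

abbreviation "S \<equiv> poly_functions scale"
abbreviation "E \<equiv> poly_endos scale"
abbreviation "M \<equiv> mult_op scale"

lemma S_const: "(\<lambda>v. c) \<in> S"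
  by (rule poly_functions.const)

lemma S_0 [simp, intro]: "0 \<in> S" and S_1 [simp, intro]: "1 \<in> S"
  using S_const[of 0] S_const[of 1] by (simp_all add: zero_fun_def one_fun_def)

lemma S_add [simp, intro]: "f \<in> S \<Longrightarrow> g \<in> S \<Longrightarrow> f + g \<in> S"
  by (rule poly_functions.add)

lemma S_mult [simp, intro]: "f \<in> S \<Longrightarrow> g \<in> S \<Longrightarrow> f * g \<in> S"
  by (rule poly_functions.mult)

lemma smult_eq: "(\<lambda>v. c * f v) = (\<lambda>v. c) * f" for f :: "'v \<Rightarrow> 'k"
  by (auto simp: fun_eq_iff fun_apply)

lemma S_uminus [simp, intro]: "f \<in> S \<Longrightarrow> - f \<in> S"
  using S_mult[OF S_const[of "-1"], of f] by (simp add: fun_Compl_def times_fun_def)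

lemma S_diff [simp, intro]: "f \<in> S \<Longrightarrow> g \<in> S \<Longrightarrow> f - g \<in> S"
  using S_add[of f "- g"] by simp

lemma S_sum [simp, intro]: "(\<And>i. i \<in> A \<Longrightarrow> f i \<in> S) \<Longrightarrow> sum f A \<in> S"
  by (induction A rule: infinite_finite_induct) auto

lemma S_power [simp, intro]: "f \<in> S \<Longrightarrow> f ^ n \<in> S"
  by (induction n) auto

lemma S_of_nat [simp, intro]: "of_nat n \<in> S"
  by (induction n) auto

text \<open>Restriction to lines reduces facts about \<open>S\<close> to polynomials in one
  variable: the absence of zero divisors, and later the directional derivative as the coefficient of
  \<open>t\<close>.\<close>

lemma poly_on_line:
  assumes "f \<in> S"
  shows "\<exists>p. \<forall>t. f (a + scale t b) = poly p t"
  using assms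
proof induction
  case (const c)
  show ?case by (rule exI[of _ "[:c:]"]) simp
next
  case (linear \<alpha>)
  then interpret l: Vector_Spaces.linear scale "(*)" \<alpha> .
  show ?case by (rule exI[of _ "[:\<alpha> a, \<alpha> b:]"]) (simp add: l.add l.scale)
next
  case (add f g)
  then obtain p q where "\<forall>t. f (a + scale t b) = poly p t" "\<forall>t. g (a + scale t b) = poly q t"
    by auto
  then show ?case by (intro exI[of _ "p + q"]) (simp add: fun_apply)
next
  case (mult f g)
  then obtain p q where "\<forall>t. f (a + scale t b) = poly p t" "\<forall>t. g (a + scale t b) = poly q t"
    by auto
  then show ?case by (intro exI[of _ "p * q"]) (simp add: fun_apply)
qed

text \<open>On the line through a point with \<open>f a \<noteq> 0\<close> and a point with
  \<open>g b \<noteq> 0\<close> both functions are non-zero one-variable polynomials. Over an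
  infinite field their product cannot vanish on the whole line.\<close>

lemma S_no_zero_divisors:
  assumes "f \<in> S" "g \<in> S" "f * g = 0"
  shows "f = 0 \<or> g = 0"
proof (rule ccontr)
  assume "\<not> (f = 0 \<or> g = 0)"
  then obtain a b where ab: "f a \<noteq> 0" "g b \<noteq> 0" by (auto simp: fun_eq_iff fun_apply)
  obtain p q where pq: "\<forall>t. f (a + scale t (b - a)) = poly p t"
      "\<forall>t. g (a + scale t (b - a)) = poly q t"
    using poly_on_line assms by meson
  have "poly (p * q) t = 0" for t
    using fun_cong[OF assms(3), of "a + scale t (b - a)"] pq by (simp add: fun_apply)
  then have "p * q = 0" by (intro poly_all_0_iff_0[THEN iffD1]) auto
  moreover have "poly p 0 \<noteq> 0" using ab pq(1)[rule_format, of 0] by simp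
  moreover have "poly q 1 \<noteq> 0" using ab pq(2)[rule_format, of 1] by simp
  ultimately show False by auto
qed

lemma S_cancel:
  assumes "f \<in> S" "f \<noteq> 0" "g \<in> S" "h \<in> S" "f * g = f * h"
  shows "g = h"
  using S_no_zero_divisors[of f "g - h"] assms by (auto simp: algebra_simps)

lemma S_mult_nonzero: "f \<in> S \<Longrightarrow> g \<in> S \<Longrightarrow> f \<noteq> 0 \<Longrightarrow> g \<noteq> 0 \<Longrightarrow> f * g \<noteq> 0"
  using S_no_zero_divisors by blast

lemma S_power_nonzero: "f \<in> S \<Longrightarrow> f \<noteq> 0 \<Longrightarrow> f ^ n \<noteq> 0"
  by (induction n) (simp, metis S_mult_nonzero S_power power_Suc)

lemma of_nat_eq_const: "of_nat n = (\<lambda>v::'v. of_nat n :: 'k)"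
  by (induction n) (auto simp: fun_eq_iff fun_apply)

lemma const_mult: "(\<lambda>v. c) * (\<lambda>v. d) = (\<lambda>v. c * d)" for c d :: 'k
  by (auto simp: fun_eq_iff fun_apply)

subsection \<open>Operators\<close>

text \<open>A rewrite rule for \<open>u (f + g)\<close> with variable \<open>u\<close> would match any term; hence an explicit application.\<close>

definition app :: "(('v \<Rightarrow> 'k) \<Rightarrow> 'v \<Rightarrow> 'k) \<Rightarrow> ('v \<Rightarrow> 'k) \<Rightarrow> 'v \<Rightarrow> 'k" (infixl "\<cdot>" 75)
  where "u \<cdot> f = u f"

lemma app_zero_op [simp]: "0 \<cdot> f = 0"
  and app_add [simp]: "(u + w) \<cdot> f = u \<cdot> f + w \<cdot> f"
  and app_diff [simp]: "(u - w) \<cdot> f = u \<cdot> f - w \<cdot> f"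
  and app_uminus [simp]: "(- u) \<cdot> f = - (u \<cdot> f)"
  and app_sum [simp]: "sum h A \<cdot> f = (\<Sum>i\<in>A. h i \<cdot> f)"
  and app_comp [simp]: "(u \<circ> w) \<cdot> f = u \<cdot> (w \<cdot> f)"
  unfolding app_def fun_apply sum_fun_apply o_apply by (rule refl)+

lemma E_outside: "u \<in> E \<Longrightarrow> f \<notin> S \<Longrightarrow> u f = 0"
  by (auto simp: poly_endos_def)

lemma E_closed [simp, intro]: "u \<in> E \<Longrightarrow> u \<cdot> f \<in> S"
  by (cases "f \<in> S") (auto simp: poly_endos_def app_def)

lemma E_add_arg [simp]: "u \<in> E \<Longrightarrow> f \<in> S \<Longrightarrow> g \<in> S \<Longrightarrow> u \<cdot> (f + g) = u \<cdot> f + u \<cdot> g"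
  by (auto simp: poly_endos_def app_def)

lemma E_const_arg: "u \<in> E \<Longrightarrow> f \<in> S \<Longrightarrow> u \<cdot> ((\<lambda>v. c) * f) = (\<lambda>v. c) * (u \<cdot> f)"
  by (auto simp: poly_endos_def smult_eq[symmetric] app_def)

lemma E_zero_arg [simp]: "u \<in> E \<Longrightarrow> u \<cdot> 0 = 0"
  using E_add_arg[of u 0 0] by (simp del: E_add_arg)

lemma E_uminus_arg [simp]: "u \<in> E \<Longrightarrow> f \<in> S \<Longrightarrow> u \<cdot> (- f) = - (u \<cdot> f)"
  using E_add_arg[of u f "- f"] by (simp add: add_eq_0_iff del: E_add_arg)

lemma E_diff_arg [simp]: "u \<in> E \<Longrightarrow> f \<in> S \<Longrightarrow> g \<in> S \<Longrightarrow> u \<cdot> (f - g) = u \<cdot> f - u \<cdot> g"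
  using E_add_arg[of u f "- g"] by (simp del: E_add_arg)

lemma E_sum_arg:
  "u \<in> E \<Longrightarrow> (\<And>i. i \<in> A \<Longrightarrow> f i \<in> S) \<Longrightarrow> u \<cdot> sum f A = (\<Sum>i\<in>A. u \<cdot> f i)"
  by (induction A rule: infinite_finite_induct) auto

lemma E_of_nat_arg [simp]: "u \<in> E \<Longrightarrow> f \<in> S \<Longrightarrow> u \<cdot> (of_nat n * f) = of_nat n * (u \<cdot> f)"
  by (simp add: of_nat_eq_const E_const_arg)

lemma E_ext: "u \<in> E \<Longrightarrow> w \<in> E \<Longrightarrow> (\<And>f. f \<in> S \<Longrightarrow> u \<cdot> f = w \<cdot> f) \<Longrightarrow> u = w"
  by (rule ext) (metis E_outside app_def)

lemma M_apply [simp]: "g \<in> S \<Longrightarrow> M f \<cdot> g = f * g"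
  unfolding app_def mult_op_def by simp

lemma M_outside [simp]: "g \<notin> S \<Longrightarrow> M f \<cdot> g = 0"
  unfolding app_def mult_op_def by simp

lemma E_I:
  assumes "\<And>f. f \<notin> S \<Longrightarrow> u \<cdot> f = 0" "\<And>f. f \<in> S \<Longrightarrow> u \<cdot> f \<in> S"
    "\<And>f g. f \<in> S \<Longrightarrow> g \<in> S \<Longrightarrow> u \<cdot> (f + g) = u \<cdot> f + u \<cdot> g"
    "\<And>c f. f \<in> S \<Longrightarrow> u \<cdot> ((\<lambda>v. c) * f) = (\<lambda>v. c) * (u \<cdot> f)"
  shows "u \<in> E"
  using assms unfolding poly_endos_def app_def smult_eq by blast

lemma E_M [simp, intro]: "f \<in> S \<Longrightarrow> M f \<in> E"
  by (rule E_I) (auto simp: S_const algebra_simps)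

lemma E_outside_app [simp]: "u \<in> E \<Longrightarrow> f \<notin> S \<Longrightarrow> u \<cdot> f = 0"
  by (simp add: E_outside app_def)

lemma E_0 [simp, intro]: "0 \<in> E"
  by (rule E_I) auto

lemma E_add [simp, intro]: "u \<in> E \<Longrightarrow> w \<in> E \<Longrightarrow> u + w \<in> E"
  by (rule E_I) (auto simp: E_const_arg distrib_left)

lemma E_uminus [simp, intro]: "u \<in> E \<Longrightarrow> - u \<in> E"
  by (rule E_I) (auto simp: E_const_arg)

lemma E_diff [simp, intro]: "u \<in> E \<Longrightarrow> w \<in> E \<Longrightarrow> u - w \<in> E"
  using E_add[of u "- w"] by simp

lemma E_comp [simp, intro]: "u \<in> E \<Longrightarrow> w \<in> E \<Longrightarrow> u \<circ> w \<in> E"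
  by (rule E_I) (auto simp: E_const_arg)

lemma E_sum [simp, intro]: "(\<And>i. i \<in> A \<Longrightarrow> u i \<in> E) \<Longrightarrow> sum u A \<in> E"
  by (induction A rule: infinite_finite_induct) auto

lemma comp_zero_left [simp]: "(0 :: ('v \<Rightarrow> 'k) \<Rightarrow> 'v \<Rightarrow> 'k) \<circ> u = 0"
  by (rule ext) (simp only: o_apply zero_fun_apply)

lemma comp_zero_right [simp]: "u \<in> E \<Longrightarrow> u \<circ> 0 = (0 :: ('v \<Rightarrow> 'k) \<Rightarrow> 'v \<Rightarrow> 'k)"
  by (rule E_ext) auto

lemma comp_add_left: "(u + w) \<circ> z = (u \<circ> z) + (w \<circ> z)"
  for u w :: "('v \<Rightarrow> 'k) \<Rightarrow> 'v \<Rightarrow> 'k"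
  by (rule ext) (simp only: o_apply fun_apply)

lemma comp_diff_left: "(u - w) \<circ> z = (u \<circ> z) - (w \<circ> z)"
  for u w :: "('v \<Rightarrow> 'k) \<Rightarrow> 'v \<Rightarrow> 'k"
  by (rule ext) (simp only: o_apply fun_apply)

lemma comp_sum_left: "sum u A \<circ> z = (\<Sum>i\<in>A. u i \<circ> z)"
  for u :: "'i \<Rightarrow> ('v \<Rightarrow> 'k) \<Rightarrow> 'v \<Rightarrow> 'k"
  by (induction A rule: infinite_finite_induct) (simp_all add: comp_add_left)

lemma comp_add_right: "u \<in> E \<Longrightarrow> w \<in> E \<Longrightarrow> z \<in> E \<Longrightarrow> u \<circ> (w + z) = (u \<circ> w) + (u \<circ> z)"
  by (rule E_ext) auto

lemma comp_diff_right: "u \<in> E \<Longrightarrow> w \<in> E \<Longrightarrow> z \<in> E \<Longrightarrow> u \<circ> (w - z) = (u \<circ> w) - (u \<circ> z)"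
  by (rule E_ext) auto

lemma comp_sum_right:
  "u \<in> E \<Longrightarrow> (\<And>i. i \<in> A \<Longrightarrow> w i \<in> E) \<Longrightarrow> u \<circ> sum w A = (\<Sum>i\<in>A. u \<circ> w i)"
  by (induction A rule: infinite_finite_induct) (auto simp: comp_add_right)

lemma M_comp: "f \<in> S \<Longrightarrow> g \<in> S \<Longrightarrow> M f \<circ> M g = M (f * g)"
  by (rule E_ext) (auto simp: mult.assoc)

lemma M_comp': "f \<in> S \<Longrightarrow> g \<in> S \<Longrightarrow> M f \<circ> (M g \<circ> u) = M (f * g) \<circ> u"
  by (simp add: M_comp comp_assoc[symmetric])

lemma M_1_comp [simp]: "u \<in> E \<Longrightarrow> M 1 \<circ> u = u"
  by (rule E_ext) auto

lemma M_0 [simp]: "M 0 = 0"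
  by (rule E_ext) auto

lemma M_add: "f \<in> S \<Longrightarrow> g \<in> S \<Longrightarrow> M (f + g) = M f + M g"
  by (rule E_ext) (auto simp: algebra_simps)

lemma M_sum: "(\<And>i. i \<in> A \<Longrightarrow> f i \<in> S) \<Longrightarrow> M (sum f A) = (\<Sum>i\<in>A. M (f i))"
  by (induction A rule: infinite_finite_induct) (auto simp: M_add)

lemma M_cancel:
  assumes "f \<in> S" "f \<noteq> 0" "u \<in> E" "w \<in> E" "M f \<circ> u = M f \<circ> w"
  shows "u = w"
proof (rule E_ext)
  fix g assume "g \<in> S"
  show "u \<cdot> g = w \<cdot> g"
  proof -
    have "(M f \<circ> u) \<cdot> g = (M f \<circ> w) \<cdot> g" by (simp only: assms(5))
    then have "f * (u \<cdot> g) = f * (w \<cdot> g)" using assms(1,3,4) \<open>g \<in> S\<close> by simp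
    then show ?thesis using S_cancel assms(1-4) by blast
  qed
qed (use assms in auto)

lemma commutator_eq: "commutator u w = (u \<circ> w) - (w \<circ> u)"
  for u w :: "('v \<Rightarrow> 'k) \<Rightarrow> 'v \<Rightarrow> 'k"
  unfolding commutator_def by (rule ext) (simp only: o_apply fun_apply)

lemma E_commutator [simp, intro]: "u \<in> E \<Longrightarrow> w \<in> E \<Longrightarrow> commutator u w \<in> E"
  by (simp add: commutator_eq)

lemma commutator_M_apply: "u \<in> E \<Longrightarrow> g \<in> S \<Longrightarrow> commutator u (M f) \<cdot> g = u \<cdot> (f * g) - f * (u \<cdot> g)"
  by (simp add: commutator_eq)

subsection \<open>The order filtration\<close>

text \<open>Orders are shifted by one, so that the induction can start with \<open>ord_less 0 = {0}\<close>.\<close>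

definition ord_less :: "nat \<Rightarrow> (('v \<Rightarrow> 'k) \<Rightarrow> 'v \<Rightarrow> 'k) set" where
  "ord_less p = (case p of 0 \<Rightarrow> {0} | Suc q \<Rightarrow> diff_ops_upto scale q)"

lemma ord_less_0: "ord_less 0 = {0}"
  by (simp add: ord_less_def)

text \<open>The shift merges the two clauses of \<open>diff_ops_upto\<close>: zero commutators are
  the case \<open>p = 0\<close> of commutators in \<open>ord_less p\<close>.\<close>

lemma ord_less_Suc: "ord_less (Suc p) = {u \<in> E. \<forall>f\<in>S. commutator u (M f) \<in> ord_less p}"
  by (cases p) (auto simp: ord_less_def zero_fun_def)

lemma ord_less_E: "u \<in> ord_less p \<Longrightarrow> u \<in> E"
  by (cases p) (auto simp: ord_less_0 ord_less_Suc)

lemma ord_less_add: "u \<in> ord_less p \<Longrightarrow> w \<in> ord_less p \<Longrightarrow> u + w \<in> ord_less p"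
proof (induction p arbitrary: u w)
  case (Suc p)
  have "commutator (u + w) (M f) = commutator u (M f) + commutator w (M f)" if "f \<in> S" for f
    using Suc.prems that
    by (intro E_ext) (auto simp: ord_less_Suc commutator_M_apply algebra_simps)
  with Suc show ?case by (auto simp: ord_less_Suc)
qed (auto simp: ord_less_0)

lemma ord_less_zero [simp, intro]: "0 \<in> ord_less p"
proof (induction p)
  case (Suc p)
  have "commutator 0 (M f) = 0" if "f \<in> S" for f
    using that by (intro E_ext) (auto simp: commutator_M_apply)
  with Suc show ?case by (auto simp: ord_less_Suc)
qed (auto simp: ord_less_0)

lemma ord_less_M: "u \<in> ord_less p \<Longrightarrow> f \<in> S \<Longrightarrow> M f \<circ> u \<in> ord_less p"
proof (induction p arbitrary: u)
  case (Suc p)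
  have "commutator (M f \<circ> u) (M g) = M f \<circ> commutator u (M g)" if "g \<in> S" for g
    using Suc.prems that
    by (intro E_ext) (auto simp: ord_less_Suc commutator_M_apply algebra_simps)
  with Suc show ?case by (auto simp: ord_less_Suc)
qed (auto simp: ord_less_0)

lemma ord_less_mono_Suc: "u \<in> ord_less p \<Longrightarrow> u \<in> ord_less (Suc p)"
proof (induction p arbitrary: u)
  case (Suc p)
  then show ?case by (auto simp: ord_less_Suc[of "Suc p"] ord_less_E) (simp add: ord_less_Suc)
qed (auto simp: ord_less_0)

lemma ord_less_mono: "p \<le> q \<Longrightarrow> u \<in> ord_less p \<Longrightarrow> u \<in> ord_less q"
  by (induction q rule: dec_induct) (auto intro: ord_less_mono_Suc)

lemma ord_less_commutator: "u \<in> ord_less (Suc p) \<Longrightarrow> f \<in> S \<Longrightarrow> commutator u (M f) \<in> ord_less p"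
  by (auto simp: ord_less_Suc)

text \<open>Induction via \<open>[u w, f] = u [w, f] + [u, f] w\<close>. With shifted orders the
  bound is one above the sharp one; it suffices for closing \<open>diff_ops\<close> under
  composition.\<close>

lemma ord_less_comp: "u \<in> ord_less p \<Longrightarrow> w \<in> ord_less q \<Longrightarrow> u \<circ> w \<in> ord_less (p + q)"
proof (induction "p + q" arbitrary: p q u w rule: less_induct)
  case less
  show ?case
  proof (cases "p = 0 \<or> q = 0")
    case True
    have "u \<in> E" using less.prems ord_less_E by blast
    with True less.prems have "u \<circ> w = 0" by (auto simp: ord_less_0)
    then show ?thesis by simp
  next
    case False
    then obtain p' q' where pq: "p = Suc p'" "q = Suc q'" by (meson not0_implies_Suc)
    have E: "u \<in> E" "w \<in> E" using less.prems ord_less_E by auto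
    have "commutator (u \<circ> w) (M f) \<in> ord_less (Suc (p' + q'))" if f: "f \<in> S" for f
    proof -
      have "commutator (u \<circ> w) (M f) = (u \<circ> commutator w (M f)) + (commutator u (M f) \<circ> w)"
        using f E by (intro E_ext) (auto simp: commutator_M_apply algebra_simps)
      moreover have "u \<circ> commutator w (M f) \<in> ord_less (Suc p' + q')"
        using less.prems f pq by (intro less.hyps) (auto intro: ord_less_commutator)
      moreover have "commutator u (M f) \<circ> w \<in> ord_less (p' + Suc q')"
        using less.prems f pq by (intro less.hyps) (auto intro: ord_less_commutator)
      ultimately show ?thesis by (auto intro!: ord_less_add)
    qed
    then show ?thesis unfolding pq using E by (simp add: ord_less_Suc[of "Suc (p' + q')"])
  qed
qed

lemma diff_ops_iff: "u \<in> diff_ops scale \<longleftrightarrow> (\<exists>p. u \<in> ord_less p)"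
proof
  assume "\<exists>p. u \<in> ord_less p"
  then obtain p where "u \<in> ord_less (Suc p)" using ord_less_mono_Suc by blast
  then show "u \<in> diff_ops scale" by (auto simp: diff_ops_def ord_less_def)
next
  assume "u \<in> diff_ops scale"
  then obtain p where "u \<in> diff_ops_upto scale p" by (auto simp: diff_ops_def)
  then have "u \<in> ord_less (Suc p)" by (simp add: ord_less_def)
  then show "\<exists>p. u \<in> ord_less p" ..
qed

lemma diff_ops_E: "u \<in> diff_ops scale \<Longrightarrow> u \<in> E"
  using ord_less_E by (auto simp: diff_ops_iff)

lemma diff_ops_comp: "u \<in> diff_ops scale \<Longrightarrow> w \<in> diff_ops scale \<Longrightarrow> u \<circ> w \<in> diff_ops scale"
  using ord_less_comp by (fastforce simp: diff_ops_iff)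

lemma diff_ops_add: 
  assumes "u \<in> diff_ops scale" "w \<in> diff_ops scale" 
  shows "u + w \<in> diff_ops scale"
proof -
  obtain p q where "u \<in> ord_less p" "w \<in> ord_less q" using assms by (auto simp: diff_ops_iff)
  then have "u + w \<in> ord_less (p + q)"
    by (intro ord_less_add) (auto intro: ord_less_mono[of p "p + q"] ord_less_mono[of q "p + q"])
  then show ?thesis by (auto simp: diff_ops_iff)
qed

lemma diff_ops_M: "f \<in> S \<Longrightarrow> M f \<in> diff_ops scale"
proof -
  assume f: "f \<in> S"
  have "commutator (M f) (M g) = 0" if "g \<in> S" for g
    using f that by (intro E_ext) (auto simp: commutator_M_apply algebra_simps)
  then have "M f \<in> ord_less 1" using f by (auto simp: ord_less_Suc ord_less_0)
  then show ?thesis by (auto simp: diff_ops_iff)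
qed

lemma derivations_E: "\<delta> \<in> derivations scale \<Longrightarrow> \<delta> \<in> E"
  by (auto simp: derivations_def)

lemma derivation_mult:
  "\<delta> \<in> derivations scale \<Longrightarrow> f \<in> S \<Longrightarrow> g \<in> S \<Longrightarrow> \<delta> \<cdot> (f * g) = f * (\<delta> \<cdot> g) + (\<delta> \<cdot> f) * g"
  by (auto simp: derivations_def app_def)

lemma derivation_one: "\<delta> \<in> derivations scale \<Longrightarrow> \<delta> \<cdot> 1 = 0"
  using derivation_mult[of \<delta> 1 1] by simp

lemma derivation_const: "\<delta> \<in> derivations scale \<Longrightarrow> \<delta> \<cdot> (\<lambda>v. c) = 0"
  using E_const_arg[of \<delta> 1 c] derivation_one[of \<delta>] derivations_E[of \<delta>] by simp

lemma derivation_power: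
  assumes "\<delta> \<in> derivations scale" "f \<in> S"
  shows "\<delta> \<cdot> (f ^ Suc n) = of_nat (Suc n) * f ^ n * (\<delta> \<cdot> f)"
proof (induction n)
  case (Suc n)
  have "\<delta> \<cdot> (f ^ Suc (Suc n)) = f * (\<delta> \<cdot> (f ^ Suc n)) + (\<delta> \<cdot> f) * f ^ Suc n"
    using assms derivation_mult[of \<delta> f "f ^ Suc n"] by simp
  also have "\<dots> = of_nat (Suc (Suc n)) * f ^ Suc n * (\<delta> \<cdot> f)"
    unfolding Suc by (simp add: algebra_simps)
  finally show ?case .
qed simp

text \<open>\<open>[\<delta>, f]\<close> is multiplication by \<open>\<delta> \<cdot> f\<close>, and
  multiplications commute.\<close>

lemma diff_ops_derivation:
  assumes "\<delta> \<in> derivations scale"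
  shows "\<delta> \<in> diff_ops scale"
proof -
  have "commutator \<delta> (M f) \<in> ord_less 1" if "f \<in> S" for f
  proof -
    have "commutator \<delta> (M f) = M (\<delta> \<cdot> f)"
      using that assms derivations_E
      by (intro E_ext) (auto simp: commutator_M_apply derivation_mult)
    moreover have "commutator (M (\<delta> \<cdot> f)) (M g) = 0" if "g \<in> S" for g
      using that assms derivations_E
      by (intro E_ext) (auto simp: commutator_M_apply algebra_simps)
    ultimately show ?thesis 
      using assms derivations_E[of \<delta>] by (auto simp: ord_less_Suc ord_less_0)
  qed
  then have "\<delta> \<in> ord_less (Suc 1)" 
    using derivations_E[OF assms] by (subst ord_less_Suc) auto
  then show ?thesis by (auto simp: diff_ops_iff)
qed

subsection \<open>Partial derivatives and the Euler identity\<close>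

text \<open>The value of \<open>D f\<close> at \<open>v\<close> is the coefficient of
  \<open>t\<close> in \<open>f (v + t b)\<close>, so the Leibniz rule is the formula for the linear
  coefficient of a product. That \<open>D\<close> preserves \<open>S\<close> then follows by
  induction on the construction of polynomial functions.\<close>

lemma ex_directional_derivation:
  "\<exists>D\<in>derivations scale. \<forall>\<alpha>. Vector_Spaces.linear scale (*) \<alpha> \<longrightarrow> D \<cdot> \<alpha> = (\<lambda>v. \<alpha> b)"
proof -
  define P where "P f v = (THE p. \<forall>t. f (v + scale t b) = poly p t)" for f :: "'v \<Rightarrow> 'k" and v
  define D where "D f = (if f \<in> S then (\<lambda>v. coeff (P f v) 1) else 0)" for f
  \<comment> \<open>Over an infinite field a polynomial is determined by its values, which justifies
    \<open>THE\<close>.\<close>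
  have P_eq: "P f v = p" if "\<And>t. f (v + scale t b) = poly p t" for f v p
    unfolding P_def using that
    by (intro the_equality) (auto simp: poly_eq_poly_eq_iff[symmetric] fun_eq_iff)
  have P: "f (v + scale t b) = poly (P f v) t" if "f \<in> S" for f v t
    using poly_on_line[OF that, of v b] P_eq[of f v] by metis
  have P_0: "coeff (P f v) 0 = f v" if "f \<in> S" for f v
    using P[OF that, of v 0] by (simp add: poly_0_coeff_0)
  have D_const: "D \<cdot> (\<lambda>v. c) = 0" for c
  proof -
    have "P (\<lambda>v. c) v = [:c:]" for v by (rule P_eq) simp
    then show ?thesis by (simp add: D_def app_def S_const fun_eq_iff fun_apply)
  qed
  have D_linear: "D \<cdot> \<alpha> = (\<lambda>v. \<alpha> b)" if "Vector_Spaces.linear scale (*) \<alpha>" for \<alpha>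
  proof -
    interpret l: Vector_Spaces.linear scale "(*)" \<alpha> by fact
    have "P \<alpha> v = [:\<alpha> v, \<alpha> b:]" for v by (rule P_eq) (simp add: l.add l.scale)
    then show ?thesis using poly_functions.linear[OF that] by (simp add: D_def app_def fun_eq_iff)
  qed
  have D_add: "D \<cdot> (f + g) = D \<cdot> f + D \<cdot> g" if "f \<in> S" "g \<in> S" for f g
  proof -
    have "P (f + g) v = P f v + P g v" for v
      by (rule P_eq) (simp add: fun_apply P that)
    then show ?thesis using that by (simp add: D_def app_def fun_eq_iff fun_apply)
  qed
  have D_mult: "D \<cdot> (f * g) = f * (D \<cdot> g) + (D \<cdot> f) * g" if "f \<in> S" "g \<in> S" for f g
  proof -
    have "P (f * g) v = P f v * P g v" for v
      by (rule P_eq) (simp add: fun_apply P that)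
    then show ?thesis using that
      by (simp add: D_def app_def fun_eq_iff fun_apply coeff_mult P_0)
  qed
  have D_S: "D \<cdot> f \<in> S" if "f \<in> S" for f
    using that by induction (auto simp: D_const D_linear D_add D_mult S_const)
  have "D \<in> E"
    by (rule E_I) (auto simp: D_S D_add D_mult D_const S_const, simp add: D_def app_def)
  then have "D \<in> derivations scale" using D_mult by (auto simp: derivations_def app_def)
  with D_linear show ?thesis by blast
qed

text \<open>The partial derivative along \<open>b\<close>. As constants and linear forms generate
  \<open>S\<close>, the two properties determine it.\<close>

definition pd :: "'v \<Rightarrow> ('v \<Rightarrow> 'k) \<Rightarrow> 'v \<Rightarrow> 'k" where
  "pd b = (SOME D. D \<in> derivations scale \<and>
     (\<forall>\<alpha>. Vector_Spaces.linear scale (*) \<alpha> \<longrightarrow> D \<cdot> \<alpha> = (\<lambda>v. \<alpha> b)))"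

lemma pd_derivation: "pd b \<in> derivations scale"
  and pd_linear: "Vector_Spaces.linear scale (*) \<alpha> \<Longrightarrow> pd b \<cdot> \<alpha> = (\<lambda>v. \<alpha> b)"
  using someI_ex[OF ex_directional_derivation[of b, unfolded Bex_def]] unfolding pd_def by blast+

lemma pd_E [simp, intro]: "pd b \<in> E"
  using pd_derivation derivations_E by blast

abbreviation coord :: "'v \<Rightarrow> 'v \<Rightarrow> 'k" where
  "coord b \<equiv> (\<lambda>v. representation Basis v b)"

lemma linear_coord: "Vector_Spaces.linear scale (*) (coord b)"
  by (rule linear_representation[OF independent_Basis span_Basis])

lemma coord_S [simp, intro]: "coord b \<in> S"
  by (rule poly_functions.linear[OF linear_coord])

lemma linear_form_eq_sum_coord:
  assumes "Vector_Spaces.linear scale (*) \<alpha>"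
  shows "\<alpha> = (\<Sum>b\<in>Basis. (\<lambda>v. \<alpha> b) * coord b)"
proof
  fix v
  interpret l: Vector_Spaces.linear scale "(*)" \<alpha> by fact
  have "v = (\<Sum>b\<in>Basis. scale (representation Basis v b) b)"
    using sum_representation_eq[OF independent_Basis, of v Basis] span_Basis finite_Basis by simp
  then have "\<alpha> v = \<alpha> (\<Sum>b\<in>Basis. scale (representation Basis v b) b)" by simp
  also have "\<dots> = (\<Sum>b\<in>Basis. \<alpha> b * representation Basis v b)"
    by (simp add: l.sum l.scale mult.commute)
  finally show "\<alpha> v = (\<Sum>b\<in>Basis. (\<lambda>v. \<alpha> b) * coord b) v"
    by (simp add: sum_fun_apply fun_apply)
qed

text \<open>The chain rule: modulo operators of order \<open>< p - 1\<close>, the map \<open>f \<mapsto> [u, f]\<close> is a derivation.\<close>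

lemma commutator_coord_in_ord_less:
  assumes u: "u \<in> ord_less (Suc p)" and f: "f \<in> S"
  shows "commutator u (M f) - (\<Sum>b\<in>Basis. M (pd b \<cdot> f) \<circ> commutator u (M (coord b)))
    \<in> ord_less (p - 1)"
  using f
proof induction
  have uE [simp]: "u \<in> E" using ord_less_E[OF u] .
  {
    case (const c)
    have "commutator u (M (\<lambda>v. c)) = 0"
      by (rule E_ext) (auto simp: S_const commutator_M_apply E_const_arg)
    then show ?case using derivation_const[OF pd_derivation] by simp
  next
    case (linear \<alpha>)
    have "commutator u (M \<alpha>) = (\<Sum>b\<in>Basis. M (\<lambda>v. \<alpha> b) \<circ> commutator u (M (coord b)))" (is "?l = ?r")
    proof (rule E_ext)
      fix g assume g: "g \<in> S"
      have "u \<cdot> (\<alpha> * g) = u \<cdot> (\<Sum>b\<in>Basis. (\<lambda>v. \<alpha> b) * (coord b * g))"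
        by (subst linear_form_eq_sum_coord[OF linear]) (simp add: sum_distrib_right mult.assoc)
      also have "\<dots> = (\<Sum>b\<in>Basis. (\<lambda>v. \<alpha> b) * (u \<cdot> (coord b * g)))"
        using g by (subst E_sum_arg) (auto simp: S_const E_const_arg)
      moreover have "\<alpha> * (u \<cdot> g) = (\<Sum>b\<in>Basis. (\<lambda>v. \<alpha> b) * (coord b * (u \<cdot> g)))"
        by (subst linear_form_eq_sum_coord[OF linear]) (simp add: sum_distrib_right mult.assoc)
      ultimately show "?l \<cdot> g = ?r \<cdot> g"
        using g by (simp add: commutator_M_apply S_const right_diff_distrib sum_subtractf)
    qed (use poly_functions.linear[OF linear] in \<open>auto simp: S_const\<close>)
    then show ?case using pd_linear[OF linear] by simp
  next
    case (add f g)
    let ?D = "\<lambda>f. commutator u (M f) - (\<Sum>b\<in>Basis. M (pd b \<cdot> f) \<circ> commutator u (M (coord b)))"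
    have "?D (f + g) = ?D f + ?D g"
    proof (rule E_ext)
      fix h assume "h \<in> S"
      then show "?D (f + g) \<cdot> h = (?D f + ?D g) \<cdot> h"
        using add.hyps by (simp add: commutator_M_apply algebra_simps sum.distrib sum_subtractf)
    qed (use add.hyps in auto)
    with add show ?case by (simp add: ord_less_add)
  next
    case (mult f g)
    let ?D = "\<lambda>f. commutator u (M f) - (\<Sum>b\<in>Basis. M (pd b \<cdot> f) \<circ> commutator u (M (coord b)))"
    \<comment> \<open>By \<open>[u, f g] = g [u, f] + f [u, g] + [[u, f], g]\<close>, the double
      commutator is the only deviation from the Leibniz rule.\<close>
    have "?D (f * g) = (M g \<circ> ?D f) + (M f \<circ> ?D g) + commutator (commutator u (M f)) (M g)"
    proof (rule E_ext)
      fix h assume "h \<in> S"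
      then show "?D (f * g) \<cdot> h =
        ((M g \<circ> ?D f) + (M f \<circ> ?D g) + commutator (commutator u (M f)) (M g)) \<cdot> h"
        using mult.hyps
        by (simp add: commutator_M_apply derivation_mult[OF pd_derivation] algebra_simps
            sum.distrib sum_subtractf sum_distrib_left)
    qed (use mult.hyps in \<open>auto intro!: E_add E_comp E_diff E_sum\<close>)
    \<comment> \<open>For \<open>p = 0\<close> the commutator of \<open>u\<close> with
      \<open>f\<close> vanishes, so the truncated \<open>p - 1\<close> is harmless; otherwise each
      commutator lowers the bound by one.\<close>
    moreover have "commutator (commutator u (M f)) (M g) \<in> ord_less (p - 1)"
      using ord_less_commutator[OF u mult.hyps(1)] ord_less_commutator[of _ "p - 1" g] mult.hyps
      by (cases p) (auto simp: ord_less_0 commutator_def)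
    ultimately show ?case using mult by (auto intro!: ord_less_add ord_less_M)
  }
qed

text \<open>This is the identity \<open>p \<sigma> = \<Sum>\<^sub>b \<xi>\<^sub>b \<partial>\<sigma>/\<partial>\<xi>\<^sub>b\<close> for the symbol \<open>\<sigma>\<close> of \<open>u\<close>.\<close>

lemma euler_in_ord_less:
  "u \<in> ord_less (Suc p) \<Longrightarrow>
    (M (of_nat p) \<circ> u) - (\<Sum>b\<in>Basis. pd b \<circ> commutator u (M (coord b))) \<in> ord_less p"
proof (induction p arbitrary: u)
  case 0
  have "u \<in> E" using ord_less_E[OF 0] .
  moreover have "commutator u (M (coord b)) = 0" for b
    using ord_less_commutator[OF 0, of "coord b"] by (simp add: ord_less_0)
  ultimately show ?case by simp
next
  case (Suc p)
  have uE [simp]: "u \<in> E" using ord_less_E[OF Suc.prems] .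
  let ?R = "\<lambda>p u. (M (of_nat p) \<circ> u) - (\<Sum>b\<in>Basis. pd b \<circ> commutator u (M (coord b)))"
  have "commutator (?R (Suc p) u) (M f) \<in> ord_less p" if f: "f \<in> S" for f
  proof -
    let ?w = "commutator u (M f)"
    \<comment> \<open>Moving \<open>f\<close> past \<open>pd b\<close> produces a term with
      \<open>pd b \<cdot> f\<close>. By the chain rule these terms add up to one copy of
      \<open>[u, f]\<close> modulo lower order, which turns the factor \<open>p + 1\<close> into
      \<open>p\<close>.\<close>
    have "commutator (?R (Suc p) u) (M f) =
        ?R p ?w + (?w - (\<Sum>b\<in>Basis. M (pd b \<cdot> f) \<circ> commutator u (M (coord b))))" (is "?l = ?r")
    proof (rule E_ext)
      fix g assume "g \<in> S"
      then show "?l \<cdot> g = ?r \<cdot> g"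
        using f by (simp add: commutator_M_apply derivation_mult[OF pd_derivation] algebra_simps
            sum.distrib sum_subtractf sum_distrib_left)
    qed (use f in \<open>auto intro!: E_commutator\<close>)
    moreover have "?R p ?w \<in> ord_less p"
      using Suc.IH ord_less_commutator[OF Suc.prems f] .
    ultimately show ?thesis
      using commutator_coord_in_ord_less[OF Suc.prems f] by (simp add: ord_less_add)
  qed
  then show ?case by (subst ord_less_Suc) auto
qed

subsection \<open>Defining polynomials\<close>

lemma S_prod: "(\<And>i. i \<in> A \<Longrightarrow> f i \<in> S) \<Longrightarrow> prod f A \<in> S"
  by (induction A rule: infinite_finite_induct) auto

lemma S_prod_nonzero:
  assumes "finite A" "\<And>i. i \<in> A \<Longrightarrow> f i \<in> S" "\<And>i. i \<in> A \<Longrightarrow> f i \<noteq> 0"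
  shows "prod f A \<noteq> 0"
  using assms
proof (induction A rule: finite_induct)
  case (insert i A)
  then have "f i * prod f A \<noteq> 0" by (intro S_mult_nonzero S_prod) auto
  then show ?case using insert.hyps by simp
qed simp

text \<open>If \<open>\<alpha> e \<noteq> 0\<close>, then the space is the sum of the common kernel
  and the line through \<open>e\<close>, so \<open>\<beta>\<close> is determined by its value at
  \<open>e\<close>.\<close>

lemma linear_forms_proportional:
  assumes "Vector_Spaces.linear scale (*) \<alpha>" "Vector_Spaces.linear scale (*) \<beta>"
    and ker: "{v. \<alpha> v = 0} = {v. \<beta> v = 0}"
  shows "\<exists>k. \<beta> = \<alpha> * (\<lambda>v. k)"
proof (cases "\<exists>v. \<alpha> v \<noteq> 0")
  case False
  then have "\<beta> = \<alpha> * (\<lambda>v. 0)" using ker by (auto simp: fun_eq_iff times_fun_apply)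
  then show ?thesis by blast
next
  case True
  then obtain e where e: "\<alpha> e \<noteq> 0" by blast
  interpret a: Vector_Spaces.linear scale "(*)" \<alpha> by fact
  interpret b: Vector_Spaces.linear scale "(*)" \<beta> by fact
  have eq: "\<beta> v = \<alpha> v * (\<beta> e / \<alpha> e)" for v
  proof -
    have "\<alpha> (v - scale (\<alpha> v / \<alpha> e) e) = 0" using e by (simp add: a.diff a.scale)
    then have "\<beta> (v - scale (\<alpha> v / \<alpha> e) e) = 0" using ker by blast
    then show ?thesis by (simp add: b.diff b.scale)
  qed
  have "\<beta> = \<alpha> * (\<lambda>v. \<beta> e / \<alpha> e)" by (rule ext, unfold times_fun_apply, rule eq)
  then show ?thesis by blast
qed

lemma defining_polynomial_S: "defining_polynomial scale \<A> Q \<Longrightarrow> Q \<in> S"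
  unfolding defining_polynomial_def by (elim exE conjE, simp only:, rule S_prod)
    (auto intro: poly_functions.linear)

text \<open>The kernel of the zero form is the whole space, which is not of codimension one; and a
  product of non-zero elements of a domain is non-zero.\<close>

lemma defining_polynomial_nonzero:
  assumes "central_arrangement scale \<A>" "defining_polynomial scale \<A> Q"
  shows "Q \<noteq> 0"
proof -
  obtain \<alpha> where \<alpha>: "\<forall>H\<in>\<A>. Vector_Spaces.linear scale (*) (\<alpha> H) \<and> {v. \<alpha> H v = 0} = H"
    "Q = (\<Prod>H\<in>\<A>. \<alpha> H)"
    using assms(2) unfolding defining_polynomial_def by blast
  have "\<alpha> H \<noteq> 0" if H: "H \<in> \<A>" for H
  proof
    assume "\<alpha> H = 0"
    moreover have "{v. \<alpha> H v = 0} = H" using \<alpha> H by blast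
    ultimately have "H = UNIV" by (auto simp: zero_fun_apply)
    then show False using assms(1) H by (auto simp: central_arrangement_def)
  qed
  then show ?thesis
    unfolding \<alpha>(2) using \<alpha>(1) assms(1)
    by (intro S_prod_nonzero) (auto simp: central_arrangement_def intro: poly_functions.linear)
qed

lemma defining_polynomial_dvd:
  assumes "defining_polynomial scale \<A> Q" "defining_polynomial scale \<A> Q'"
  shows "\<exists>c\<in>S. Q' = Q * c"
proof -
  obtain \<alpha> where \<alpha>: "\<forall>H\<in>\<A>. Vector_Spaces.linear scale (*) (\<alpha> H) \<and> {v. \<alpha> H v = 0} = H"
    "Q = (\<Prod>H\<in>\<A>. \<alpha> H)"
    using assms(1) unfolding defining_polynomial_def by blast
  obtain \<beta> where \<beta>: "\<forall>H\<in>\<A>. Vector_Spaces.linear scale (*) (\<beta> H) \<and> {v. \<beta> H v = 0} = H"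
    "Q' = (\<Prod>H\<in>\<A>. \<beta> H)"
    using assms(2) unfolding defining_polynomial_def by blast
  have "\<forall>H\<in>\<A>. \<exists>k. \<beta> H = \<alpha> H * (\<lambda>v. k)"
  proof
    fix H assume "H \<in> \<A>"
    then show "\<exists>k. \<beta> H = \<alpha> H * (\<lambda>v. k)"
      using \<alpha>(1) \<beta>(1) by (intro linear_forms_proportional) auto
  qed
  from bchoice[OF this] obtain k where "\<And>H. H \<in> \<A> \<Longrightarrow> \<beta> H = \<alpha> H * (\<lambda>v. k H)" by blast
  then have "Q' = Q * (\<Prod>H\<in>\<A>. (\<lambda>v. k H))"
    unfolding \<alpha>(2) \<beta>(2) by (simp add: prod.distrib[symmetric] cong: prod.cong)
  moreover have "(\<Prod>H\<in>\<A>. (\<lambda>v. k H)) \<in> S" by (rule S_prod[OF S_const])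
  ultimately show ?thesis by (rule bexI)
qed

text \<open>Two defining polynomials divide each other and hence generate the same ideal. This
  carries freeness, which is asserted for some defining polynomial, over to the given one.\<close>

lemma tangent_derivations_cong:
  assumes "defining_polynomial scale \<A> Q" "defining_polynomial scale \<A> Q'"
  shows "tangent_derivations scale Q = tangent_derivations scale Q'"
proof -
  have "{Q2 * f |f. f \<in> S} \<subseteq> {Q1 * f |f. f \<in> S}"
    if def12: "defining_polynomial scale \<A> Q1" "defining_polynomial scale \<A> Q2" for Q1 Q2
  proof -
    obtain c where "c \<in> S" "Q2 = Q1 * c" using defining_polynomial_dvd[OF def12] by (rule bexE)
    then show ?thesis by (auto simp: mult.assoc)
  qed
  then have "{Q * f |f. f \<in> S} = {Q' * f |f. f \<in> S}" using assms by (intro equalityI) simp_all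
  then show ?thesis by (simp only: tangent_derivations_def)
qed

end

section \<open>A polynomial whose tangent derivations have a basis\<close>

locale free_divisor = polynomial_operators scale Basis
  for scale :: "'k::field_char_0 \<Rightarrow> 'v::ab_group_add \<Rightarrow> 'v" and Basis :: "'v set" +
  fixes Q :: "'v \<Rightarrow> 'k" and B :: "(('v \<Rightarrow> 'k) \<Rightarrow> 'v \<Rightarrow> 'k) set"
  assumes Q_S [simp, intro]: "Q \<in> S" and Q_nonzero: "Q \<noteq> 0"
    and basis: "poly_basis scale (tangent_derivations scale Q) B"
begin

abbreviation "L \<equiv> tangent_derivations scale Q"

text \<open>By the Leibniz rule, stability of the ideal \<open>Q S\<close> can be tested on the
  generator \<open>Q\<close>. The quotient \<open>h\<close> is the logarithmic derivative of
  \<open>Q\<close> along \<open>\<delta>\<close>.\<close>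

lemma L_iff: "\<delta> \<in> L \<longleftrightarrow> \<delta> \<in> derivations scale \<and> (\<exists>h\<in>S. \<delta> \<cdot> Q = Q * h)"
proof
  assume \<delta>: "\<delta> \<in> L"
  then have "\<delta> (Q * 1) \<in> {Q * f |f. f \<in> S}" unfolding tangent_derivations_def by blast
  then show "\<delta> \<in> derivations scale \<and> (\<exists>h\<in>S. \<delta> \<cdot> Q = Q * h)"
    using \<delta> by (auto simp: tangent_derivations_def app_def)
next
  assume *: "\<delta> \<in> derivations scale \<and> (\<exists>h\<in>S. \<delta> \<cdot> Q = Q * h)"
  then obtain h where h: "h \<in> S" "\<delta> \<cdot> Q = Q * h" by auto
  have "\<delta> \<cdot> (Q * f) = Q * (\<delta> \<cdot> f + h * f)" if "f \<in> S" for f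
    using derivation_mult[of \<delta> Q f] * that h by (simp add: algebra_simps)
  then have "\<delta> (Q * f) = Q * (\<delta> \<cdot> f + h * f)" if "f \<in> S" for f
    using that unfolding app_def by blast
  moreover have "\<delta> \<cdot> f + h * f \<in> S" if "f \<in> S" for f
    using that * h derivations_E by auto
  ultimately show "\<delta> \<in> L" using * unfolding tangent_derivations_def by blast
qed

lemma L_E: "\<delta> \<in> L \<Longrightarrow> \<delta> \<in> E"
  by (auto simp: L_iff derivations_E)

lemma L_mult: "\<delta> \<in> L \<Longrightarrow> f \<in> S \<Longrightarrow> g \<in> S \<Longrightarrow> \<delta> \<cdot> (f * g) = f * (\<delta> \<cdot> g) + (\<delta> \<cdot> f) * g"
  by (auto simp: L_iff derivation_mult)

lemma derivationsI:
  "\<delta> \<in> E \<Longrightarrow> (\<And>f g. f \<in> S \<Longrightarrow> g \<in> S \<Longrightarrow> \<delta> \<cdot> (f * g) = f * (\<delta> \<cdot> g) + (\<delta> \<cdot> f) * g)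
    \<Longrightarrow> \<delta> \<in> derivations scale"
  by (auto simp: derivations_def app_def)

text \<open>Closure under brackets is what allows the letters of a word in \<open>B\<close> to be
  permuted at the cost of shorter words.\<close>

lemma L_lie_bracket:
  assumes "\<delta> \<in> L" "\<epsilon> \<in> L"
  shows "(\<delta> \<circ> \<epsilon>) - (\<epsilon> \<circ> \<delta>) \<in> L"
proof -
  note [simp] = L_E[OF assms(1)] L_E[OF assms(2)]
  obtain h k where "h \<in> S" "\<delta> \<cdot> Q = Q * h" "k \<in> S" "\<epsilon> \<cdot> Q = Q * k"
    using assms by (auto simp: L_iff)
  then have "((\<delta> \<circ> \<epsilon>) - (\<epsilon> \<circ> \<delta>)) \<cdot> Q = Q * (\<delta> \<cdot> k - \<epsilon> \<cdot> h)" "\<delta> \<cdot> k - \<epsilon> \<cdot> h \<in> S"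
    using assms by (auto simp: L_mult algebra_simps)
  moreover have "(\<delta> \<circ> \<epsilon>) - (\<epsilon> \<circ> \<delta>) \<in> derivations scale"
    by (rule derivationsI) (auto simp: L_mult[OF assms(1)] L_mult[OF assms(2)] algebra_simps)
  ultimately show ?thesis unfolding L_iff by blast
qed

text \<open>This places \<open>Q\<close> times each partial derivative in the \<open>S\<close>-span
  of \<open>B\<close>; it is why powers of \<open>Q\<close> suffice as denominators.\<close>

lemma Q_pd_in_L: "M Q \<circ> pd b \<in> L"
proof -
  have "M Q \<circ> pd b \<in> derivations scale"
    by (rule derivationsI) (auto simp: derivation_mult[OF pd_derivation] algebra_simps)
  moreover have "(M Q \<circ> pd b) \<cdot> Q = Q * (pd b \<cdot> Q)" by simp
  ultimately show ?thesis using E_closed[OF pd_E, of b Q] unfolding L_iff by blast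
qed

lemma poly_combination_eq: "poly_combination scale F c = (\<Sum>b\<in>F. M (c b) \<circ> b)"
  by (rule ext) (simp only: poly_combination_def sum_fun_apply o_apply)

lemma B_L: "b \<in> B \<Longrightarrow> b \<in> L"
  using basis[unfolded poly_basis_def, THEN conjunct1] by (rule subsetD)

lemma B_E: "b \<in> B \<Longrightarrow> b \<in> E"
  by (rule L_E[OF B_L])

lemma L_spanned:
  assumes "\<delta> \<in> L"
  obtains F c where "finite F" "F \<subseteq> B" "\<And>b. b \<in> F \<Longrightarrow> c b \<in> S" "\<delta> = (\<Sum>b\<in>F. M (c b) \<circ> b)"
proof -
  have "\<exists>F c. finite F \<and> F \<subseteq> B \<and> c ` F \<subseteq> S \<and> \<delta> = poly_combination scale F c"
    using basis[unfolded poly_basis_def, THEN conjunct2, THEN conjunct1] assms by (rule bspec)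
  then obtain F c where "finite F" "F \<subseteq> B" "c ` F \<subseteq> S" "\<delta> = poly_combination scale F c"
    by (elim exE conjE)
  then show ?thesis by (intro that[of F c]) (auto simp: poly_combination_eq)
qed

lemma B_independent:
  assumes "finite F" "F \<subseteq> B" "\<And>b. b \<in> F \<Longrightarrow> c b \<in> S" "(\<Sum>b\<in>F. M (c b) \<circ> b) = 0" "b \<in> F"
  shows "c b = 0"
proof -
  have "poly_combination scale F c = (\<lambda>g. 0)"
    unfolding poly_combination_eq assms(4) zero_fun_def ..
  moreover have "c ` F \<subseteq> S" using assms(3) by blast
  ultimately have "\<forall>b\<in>F. c b = 0"
    using basis[unfolded poly_basis_def, THEN conjunct2, THEN conjunct2] assms(1,2) by (elim allE impE)
  then show ?thesis using assms(5) by (rule bspec)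
qed

subsection \<open>Words in the basis\<close>

primrec word_op :: "(('v \<Rightarrow> 'k) \<Rightarrow> 'v \<Rightarrow> 'k) list \<Rightarrow> ('v \<Rightarrow> 'k) \<Rightarrow> 'v \<Rightarrow> 'k" where
  "word_op [] = M 1"
| "word_op (b # w) = b \<circ> word_op w"

lemma word_op_E [simp, intro]: "set w \<subseteq> B \<Longrightarrow> word_op w \<in> E"
  by (induction w) (auto intro: B_E)

text \<open>The bound on the length is strict, in parallel to \<open>ord_less\<close>, so that
  inductions start from \<open>word_span 0 = {0}\<close>. Adding one term at a time provides an
  induction rule for linear combinations.\<close>

inductive_set word_span :: "nat \<Rightarrow> (('v \<Rightarrow> 'k) \<Rightarrow> 'v \<Rightarrow> 'k) set" for p where
  zero: "0 \<in> word_span p"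
| add_term: "v \<in> word_span p \<Longrightarrow> f \<in> S \<Longrightarrow> set w \<subseteq> B \<Longrightarrow> length w < p
    \<Longrightarrow> v + (M f \<circ> word_op w) \<in> word_span p"

lemma word_span_E [simp, intro]: "v \<in> word_span p \<Longrightarrow> v \<in> E"
  by (induction rule: word_span.induct) auto

lemma word_span_0: "word_span 0 = {0}"
proof -
  have "v = 0" if "v \<in> word_span 0" for v using that by induction auto
  then show ?thesis using word_span.zero by blast
qed

lemma word_span_term: "f \<in> S \<Longrightarrow> set w \<subseteq> B \<Longrightarrow> length w < p \<Longrightarrow> M f \<circ> word_op w \<in> word_span p"
  using add_term[OF zero, of f w p] by simp

lemma word_span_word_op: "set w \<subseteq> B \<Longrightarrow> length w < p \<Longrightarrow> word_op w \<in> word_span p"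
  using word_span_term[of 1 w p] by simp

lemma word_span_add: "v \<in> word_span p \<Longrightarrow> u \<in> word_span p \<Longrightarrow> u + v \<in> word_span p"
proof (induction rule: word_span.induct)
  case (add_term v f w)
  then show ?case using word_span.add_term[of "u + v" p f w] by (simp add: add.assoc)
qed simp

lemma word_span_M: "v \<in> word_span p \<Longrightarrow> g \<in> S \<Longrightarrow> M g \<circ> v \<in> word_span p"
proof (induction rule: word_span.induct)
  case (add_term v f w)
  have "M g \<circ> (v + (M f \<circ> word_op w)) = (M g \<circ> v) + (M (g * f) \<circ> word_op w)"
    using add_term by (subst comp_add_right) (auto simp: M_comp')
  then show ?case using add_term word_span.add_term[of "M g \<circ> v" p "g * f" w] by simp
qed (simp add: zero)

lemma word_span_uminus: "v \<in> word_span p \<Longrightarrow> - v \<in> word_span p"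
proof -
  assume v: "v \<in> word_span p"
  have "- v = M (- 1) \<circ> v" using v by (intro E_ext) auto
  with word_span_M[OF v, of "-1"] show ?thesis by auto
qed

lemma word_span_diff: "u \<in> word_span p \<Longrightarrow> v \<in> word_span p \<Longrightarrow> u - v \<in> word_span p"
  using word_span_add[of "- v" p u] word_span_uminus[of v p] by simp

lemma word_span_sum: "(\<And>i. i \<in> A \<Longrightarrow> h i \<in> word_span p) \<Longrightarrow> sum h A \<in> word_span p"
  by (induction A rule: infinite_finite_induct) (auto intro: word_span_add zero)

lemma word_span_mono: "v \<in> word_span p \<Longrightarrow> p \<le> q \<Longrightarrow> v \<in> word_span q"
  by (induction rule: word_span.induct) (auto intro: word_span.intros)

text \<open>The Leibniz rule \<open>b f = f b + b(f)\<close> brings the coefficient back to the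
  left.\<close>

lemma word_span_B: "v \<in> word_span p \<Longrightarrow> b \<in> B \<Longrightarrow> b \<circ> v \<in> word_span (Suc p)"
proof (induction rule: word_span.induct)
  case zero
  then show ?case using B_E by (simp add: word_span.zero)
next
  case (add_term v f w)
  note [simp] = B_E[OF \<open>b \<in> B\<close>]
  have "b \<circ> (v + (M f \<circ> word_op w)) = (b \<circ> v) + ((M f \<circ> word_op (b # w)) + (M (b \<cdot> f) \<circ> word_op w))"
    using add_term B_L by (intro E_ext) (auto simp: L_mult)
  then show ?case using add_term
    by (auto intro!: word_span_add word_span_term simp del: word_op.simps)
qed

lemma word_span_L:
  assumes "\<delta> \<in> L" "v \<in> word_span p"
  shows "\<delta> \<circ> v \<in> word_span (Suc p)"
proof -
  obtain F c where F: "finite F" "F \<subseteq> B" "\<And>b. b \<in> F \<Longrightarrow> c b \<in> S" "\<delta> = (\<Sum>b\<in>F. M (c b) \<circ> b)"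
    using L_spanned[OF assms(1)] by blast
  then have "\<delta> \<circ> v = (\<Sum>b\<in>F. M (c b) \<circ> (b \<circ> v))"
    by (simp add: comp_sum_left comp_assoc)
  also have "\<dots> \<in> word_span (Suc p)"
    using F assms by (intro word_span_sum word_span_M word_span_B) auto
  finally show ?thesis .
qed

text \<open>Modulo lower order, the Euler identity writes \<open>p u\<close> as a sum of terms
  \<open>pd b\<close> composed with a commutator, which again has lower order. Induction clears the
  denominators of everything of lower order, and one more factor \<open>Q\<close> turns
  \<open>pd b\<close> into an element of \<open>L\<close>.\<close>

lemma ord_less_clear_denominators:
  "u \<in> ord_less p \<Longrightarrow> \<exists>n q. M (Q ^ n) \<circ> u \<in> word_span q"
proof (induction p arbitrary: u)
  case 0
  then show ?case using zero by (auto simp: ord_less_0)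
next
  case (Suc p)
  note uE [simp] = ord_less_E[OF Suc.prems]
  define clr where "clr u \<longleftrightarrow> u \<in> E \<and> (\<exists>n q. M (Q ^ n) \<circ> u \<in> word_span q)" for u
  have clr_add: "clr (u + w)" if uw: "clr u" "clr w" for u w
  proof -
    obtain n q m r where *: "M (Q ^ n) \<circ> u \<in> word_span q" "M (Q ^ m) \<circ> w \<in> word_span r"
      using uw clr_def by auto
    have "M (Q ^ (n + m)) \<circ> (u + w) = (M (Q ^ m) \<circ> (M (Q ^ n) \<circ> u)) + (M (Q ^ n) \<circ> (M (Q ^ m) \<circ> w))"
      using uw by (intro E_ext) (auto simp: clr_def power_add algebra_simps)
    moreover have "\<dots> \<in> word_span (q + r)"
      by (rule word_span_add[OF word_span_M word_span_M])
        (auto intro: word_span_mono[OF *(1)] word_span_mono[OF *(2)])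
    ultimately have "M (Q ^ (n + m)) \<circ> (u + w) \<in> word_span (q + r)" by simp
    then show ?thesis using uw unfolding clr_def by blast
  qed
  have clr_sum: "clr (sum h A)" if "\<And>i. i \<in> A \<Longrightarrow> clr (h i)" for h and A :: "'v set"
    using that
  proof (induction A rule: infinite_finite_induct)
    case (insert x A)
    then show ?case using clr_add by simp
  qed (auto simp: clr_def intro!: zero exI)
  have clr_pd: "clr (pd b \<circ> w)" if w: "clr w" for b w
  proof -
    obtain n q where *: "M (Q ^ n) \<circ> w \<in> word_span q" using w clr_def by auto
    \<comment> \<open>The extra factor \<open>Q\<close> avoids the exponent \<open>n - 1\<close> and
      so covers \<open>n = 0\<close>.\<close>
    have "Q * (pd b \<cdot> (Q ^ n)) = of_nat n * (pd b \<cdot> Q) * Q ^ n"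
      using derivation_power[OF pd_derivation Q_S] derivation_one[OF pd_derivation]
      by (cases n) (auto simp: mult_ac)
    then have eq: "Q * ((pd b \<cdot> (Q ^ n)) * h) = of_nat n * (pd b \<cdot> Q) * (Q ^ n * h)" for h
      by (simp only: mult.assoc[symmetric])
    have "M (Q ^ Suc n) \<circ> (pd b \<circ> w) =
      ((M Q \<circ> pd b) \<circ> (M (Q ^ n) \<circ> w)) - (M (of_nat n * (pd b \<cdot> Q)) \<circ> (M (Q ^ n) \<circ> w))"
      using w by (intro E_ext)
        (auto simp: clr_def derivation_mult[OF pd_derivation] eq distrib_left mult.assoc)
    moreover have "\<dots> \<in> word_span (Suc q)"
      by (rule word_span_diff[OF word_span_L[OF Q_pd_in_L *] word_span_M[OF word_span_mono[OF *]]]) auto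
    ultimately have "M (Q ^ Suc n) \<circ> (pd b \<circ> w) \<in> word_span (Suc q)" by (simp only:)
    then show ?thesis using w unfolding clr_def by blast
  qed
  have clr_lower: "clr w" if "w \<in> ord_less p" for w
    using Suc.IH[OF that] ord_less_E[OF that] by (simp add: clr_def)
  show ?case
  proof (cases p)
    case 0
    \<comment> \<open>The Euler identity has the factor 0 here. Instead, an operator of order zero
      is multiplication by its value at 1.\<close>
    have "u = M (u \<cdot> 1)"
    proof (rule E_ext)
      fix f assume f: "f \<in> S"
      have "commutator u (M f) \<cdot> 1 = 0"
        using ord_less_commutator[OF Suc.prems f] 0 by (simp add: ord_less_0)
      then show "u \<cdot> f = M (u \<cdot> 1) \<cdot> f" using f by (simp add: commutator_M_apply mult.commute)
    qed auto
    moreover have "M (u \<cdot> 1) \<circ> word_op [] \<in> word_span 1" by (rule word_span_term) auto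
    moreover have "M (u \<cdot> 1) \<circ> word_op [] = M (u \<cdot> 1)" by (simp add: M_comp)
    ultimately have "M (Q ^ 0) \<circ> u \<in> word_span 1" by (metis M_1_comp power_0 uE)
    then show ?thesis by blast
  next
    case (Suc p')
    let ?D = "\<Sum>b\<in>Basis. pd b \<circ> commutator u (M (coord b))"
    have "clr (((M (of_nat p) \<circ> u) - ?D) + ?D)"
      using euler_in_ord_less[OF Suc.prems] ord_less_commutator[OF Suc.prems]
      by (intro clr_add clr_sum clr_pd) (auto intro: clr_lower)
    then obtain n q where *: "M (Q ^ n) \<circ> (M (of_nat p) \<circ> u) \<in> word_span q"
      by (auto simp: clr_def)
    \<comment> \<open>In characteristic zero the positive factor \<open>p\<close> can be
      removed.\<close>
    have "M (Q ^ n) \<circ> u = M (\<lambda>v. inverse (of_nat p)) \<circ> (M (Q ^ n) \<circ> (M (of_nat p) \<circ> u))"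
    proof (rule E_ext)
      fix f assume f: "f \<in> S"
      have "(\<lambda>v. inverse (of_nat p)) * of_nat p = (1 :: 'v \<Rightarrow> 'k)"
        using Suc unfolding of_nat_eq_const const_mult one_fun_def
        by (simp del: of_nat_Suc)
      moreover have "i * (m * (x * y)) = i * m * (x * y)" for i x m y :: "'v \<Rightarrow> 'k"
        by (simp only: mult_ac)
      ultimately have "(\<lambda>v. inverse (of_nat p)) * (of_nat p * (Q ^ n * (u \<cdot> f))) = Q ^ n * (u \<cdot> f)"
        by (simp only: mult_1)
      then show "(M (Q ^ n) \<circ> u) \<cdot> f =
          (M (\<lambda>v. inverse (of_nat p)) \<circ> (M (Q ^ n) \<circ> (M (of_nat p) \<circ> u))) \<cdot> f"
        using f by simp
    qed (auto intro!: E_comp simp: S_const)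
    then show ?thesis using word_span_M[OF *, of "\<lambda>v. inverse (of_nat p)"] S_const by metis
  qed
qed

subsection \<open>Commutation modulo shorter words\<close>

text \<open>This covers the truncated subtraction at \<open>p = 0\<close>, where both spans are
  zero.\<close>

lemma word_span_B_pred: "v \<in> word_span (p - 1) \<Longrightarrow> b \<in> B \<Longrightarrow> b \<circ> v \<in> word_span p"
proof (cases p)
  case (Suc q)
  then show "v \<in> word_span (p - 1) \<Longrightarrow> b \<in> B \<Longrightarrow> ?thesis" using word_span_B[of v q b] by simp
qed (simp add: word_span_0 B_E)

text \<open>The difference is the bracket of the two letters followed by \<open>w\<close>. The
  bracket lies in \<open>L\<close> and is thus a combination of single letters, so one letter is
  saved.\<close>

lemma word_op_swap:
  assumes "set w \<subseteq> B" "b \<in> B" "b' \<in> B"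
  shows "word_op (b # b' # w) - word_op (b' # b # w) \<in> word_span (length w + 2)"
proof -
  have "word_op (b # b' # w) - word_op (b' # b # w) = ((b \<circ> b') - (b' \<circ> b)) \<circ> word_op w"
    by (simp add: comp_diff_left comp_assoc)
  also have "\<dots> \<in> word_span (Suc (Suc (length w)))"
    using assms by (intro word_span_L L_lie_bracket B_L word_span_word_op) auto
  finally show ?thesis by simp
qed

lemma word_op_move_to_front:
  assumes "set x \<subseteq> B" "b \<in> B" "set y \<subseteq> B"
  shows "word_op (x @ b # y) - word_op (b # x @ y) \<in> word_span (length x + length y + 1)"
  using assms(1)
proof (induction x)
  case (Cons a x)
  then have a: "a \<in> B" "set x \<subseteq> B" by auto
  have "word_op (a # x @ b # y) - word_op (b # a # x @ y) = (a \<circ> (word_op (x @ b # y) - word_op (b # x @ y)))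
      + (word_op (a # b # x @ y) - word_op (b # a # x @ y))"
    using a assms B_E by (simp add: comp_diff_right)
  moreover have "\<dots> \<in> word_span (length (a # x) + length y + 1)"
    using word_span_B[OF Cons.IH[OF a(2)] a(1)] word_op_swap[of "x @ y" a b] a assms
    by (intro word_span_add) auto
  ultimately show ?case by (simp only: append_Cons)
qed (simp add: zero)

text \<open>The first letter of \<open>w\<close> is moved to the front of \<open>w'\<close>; the
  remaining letters are matched by induction.\<close>

lemma word_op_mset_cong:
  "set w \<subseteq> B \<Longrightarrow> mset w = mset w' \<Longrightarrow> word_op w - word_op w' \<in> word_span (length w)"
proof (induction w arbitrary: w')
  case (Cons b w)
  from Cons.prems(2) have "b \<in> set w'" by (metis list.set_intros(1) set_mset_mset)
  then obtain x y where w': "w' = x @ b # y" by (meson split_list)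
  have b: "b \<in> B" "set w \<subseteq> B" and m: "mset w = mset (x @ y)" using Cons.prems w' by auto
  have xy: "set x \<subseteq> B" "set y \<subseteq> B"
    using b(2) mset_eq_setD[OF m] by auto
  have len: "length w = length x + length y"
    using mset_eq_length[OF m] by simp
  have "word_op (b # w) - word_op w' = (b \<circ> (word_op w - word_op (x @ y))) - (word_op (x @ b # y) - word_op (b # x @ y))"
    using b xy B_E w' by (simp add: comp_diff_right)
  also have "\<dots> \<in> word_span (Suc (length w))"
    by (rule word_span_diff)
      (use word_span_B[OF Cons.IH[OF b(2) m] b(1)] word_op_move_to_front[OF xy(1) b(1) xy(2)] len
        in simp_all)
  finally show ?case by simp
qed (simp add: zero)

text \<open>By \<open>word_op_mset_cong\<close>, the choice of the word is immaterial modulo shorter words.\<close>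

definition monomial_op :: "(('v \<Rightarrow> 'k) \<Rightarrow> 'v \<Rightarrow> 'k) multiset \<Rightarrow> ('v \<Rightarrow> 'k) \<Rightarrow> 'v \<Rightarrow> 'k" where
  "monomial_op I = word_op (SOME w. mset w = I)"

lemma monomial_op_eq_word_op: "\<exists>w. mset w = I \<and> monomial_op I = word_op w"
  unfolding monomial_op_def using someI_ex[OF ex_mset[of I]] by blast

lemma monomial_op_word_span: "set_mset I \<subseteq> B \<Longrightarrow> size I < p \<Longrightarrow> monomial_op I \<in> word_span p"
  using monomial_op_eq_word_op[of I] word_span_word_op by (metis set_mset_mset size_mset)

lemma monomial_op_E [simp, intro]: "set_mset I \<subseteq> B \<Longrightarrow> monomial_op I \<in> E"
  using monomial_op_word_span[of I "Suc (size I)"] by auto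

lemma word_op_minus_monomial_op: "set w \<subseteq> B \<Longrightarrow> word_op w - monomial_op (mset w) \<in> word_span (length w)"
  using monomial_op_eq_word_op[of "mset w"] word_op_mset_cong[of w] by metis

lemma comp_monomial_op:
  assumes "b \<in> B" "set_mset J \<subseteq> B"
  shows "(b \<circ> monomial_op J) - monomial_op (add_mset b J) \<in> word_span (Suc (size J))"
proof -
  obtain w where w: "mset w = J" "monomial_op J = word_op w" using monomial_op_eq_word_op by blast
  then have "set (b # w) \<subseteq> B" using assms by auto
  from word_op_minus_monomial_op[OF this] show ?thesis using w by auto
qed

section \<open>Symbols of commutators\<close>

lemma comp_sum_mset_right:
  "u \<in> E \<Longrightarrow> (\<And>i. i \<in># I \<Longrightarrow> h i \<in> E) \<Longrightarrow> u \<circ> (\<Sum>i\<in>#I. h i) = (\<Sum>i\<in>#I. u \<circ> h i) \<and> (\<Sum>i\<in>#I. h i) \<in> E"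
  by (induction I) (auto simp: comp_add_right)

lemma word_span_sum_mset:
  "(\<And>i. i \<in># I \<Longrightarrow> h i \<in> word_span p) \<Longrightarrow> (\<Sum>i\<in>#I. h i) \<in> word_span p"
  by (induction I) (auto intro: zero word_span_add)

lemma sum_mset_subtractf: "(\<Sum>i\<in>#I. h i) - (\<Sum>i\<in>#I. k i) = (\<Sum>i\<in>#I. h i - k i)"
  for h k :: "'i \<Rightarrow> 'c::ab_group_add"
  by (induction I) (auto simp: algebra_simps)

text \<open>The operator with symbol \<open>\<Sum>\<^sub>b \<mu>\<^sub>b \<partial>(y\<^sup>I)/\<partial>y\<^sub>b\<close>.\<close>

definition symbol_deriv ::
  "((('v \<Rightarrow> 'k) \<Rightarrow> 'v \<Rightarrow> 'k) \<Rightarrow> 'v \<Rightarrow> 'k) \<Rightarrow> (('v \<Rightarrow> 'k) \<Rightarrow> 'v \<Rightarrow> 'k) multiset \<Rightarrow> ('v \<Rightarrow> 'k) \<Rightarrow> 'v \<Rightarrow> 'k"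
  where "symbol_deriv \<mu> I = (\<Sum>i\<in>#I. M (\<mu> i) \<circ> monomial_op (I - {#i#}))"

lemma symbol_deriv_word_span:
  assumes "set_mset I \<subseteq> B" "\<And>i. i \<in> B \<Longrightarrow> \<mu> i \<in> S"
  shows "symbol_deriv \<mu> I \<in> word_span (size I)"
  unfolding symbol_deriv_def
proof (intro word_span_sum_mset word_span_M monomial_op_word_span)
  fix i assume "i \<in># I"
  then show "\<mu> i \<in> S" "set_mset (I - {#i#}) \<subseteq> B" "size (I - {#i#}) < size I"
    using assms by (auto simp: size_Diff1_less dest: in_diffD)
qed

text \<open>The factor \<open>d\<close> is carried to the left: in
  \<open>[b w, f] = b [w, f] + b(f) w\<close> one has \<open>[w, f] = d v\<close>,
  \<open>b(f) = d (\<mu> b)\<close> and \<open>b d = d (b + \<nu> b)\<close>, which gives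
  \<open>d (b v + (\<nu> b) v + (\<mu> b) w)\<close>. The \<open>\<nu>\<close> term has too few
  letters to affect the symbol, and the other two follow the Leibniz rule for
  \<open>symbol_deriv\<close>.\<close>

lemma word_op_commutator:
  assumes f: "f \<in> S" and d: "d \<in> S" and \<mu>: "\<And>b. b \<in> B \<Longrightarrow> \<mu> b \<in> S \<and> b \<cdot> f = d * \<mu> b"
    and \<nu>: "\<And>b. b \<in> B \<Longrightarrow> \<nu> b \<in> S \<and> b \<cdot> d = d * \<nu> b"
  shows "set w \<subseteq> B \<Longrightarrow> \<exists>v\<in>word_span (length w). commutator (word_op w) (M f) = M d \<circ> v \<and>
    v - symbol_deriv \<mu> (mset w) \<in> word_span (length w - 1)"
proof (induction w)
  case Nil
  have "commutator (M 1) (M f) = 0" using f by (simp add: commutator_eq M_comp)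
  then show ?case using d by (auto simp: symbol_deriv_def intro!: bexI[of _ 0] zero)
next
  case (Cons b w)
  then have b: "b \<in> B" and w: "set w \<subseteq> B" by auto
  note [simp] = B_E[OF b] word_op_E[OF w]
  let ?I = "mset w"
  obtain v where v: "v \<in> word_span (length w)" "commutator (word_op w) (M f) = M d \<circ> v"
    "v - symbol_deriv \<mu> ?I \<in> word_span (length w - 1)"
    using Cons.IH w by blast
  define v' where "v' = (b \<circ> v) + (M (\<nu> b) \<circ> v) + (M (\<mu> b) \<circ> word_op w)"
  have \<mu>I: "\<mu> i \<in> S" "i \<in> B" if "i \<in># ?I" for i using w that \<mu> by auto
  have IB: "set_mset (?I - {#i#}) \<subseteq> B" for i using w by (fastforce dest: in_diffD)
  have dE: "symbol_deriv \<mu> ?I \<in> E"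
    using symbol_deriv_word_span[of ?I \<mu>] w \<mu> by auto
  have "v' \<in> word_span (length (b # w))"
    unfolding v'_def
  proof (intro word_span_add)
    show "b \<circ> v \<in> word_span (length (b # w))" using word_span_B[OF v(1) b] by simp
    show "M (\<nu> b) \<circ> v \<in> word_span (length (b # w))"
      using \<nu>[OF b] by (intro word_span_mono[OF word_span_M[OF v(1)]]) auto
    show "M (\<mu> b) \<circ> word_op w \<in> word_span (length (b # w))"
      using \<mu>[OF b] by (intro word_span_M word_span_word_op w) auto
  qed
  moreover have "commutator (word_op (b # w)) (M f) = M d \<circ> v'"
  proof (rule E_ext)
    fix g assume g: "g \<in> S"
    have "commutator (word_op w) (M f) \<cdot> g = d * (v \<cdot> g)" using v g by simp
    then have *: "word_op w \<cdot> (f * g) = d * (v \<cdot> g) + f * (word_op w \<cdot> g)"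
      using g by (simp add: commutator_M_apply algebra_simps)
    show "commutator (word_op (b # w)) (M f) \<cdot> g = (M d \<circ> v') \<cdot> g"
      using g f d v \<mu>[OF b] \<nu>[OF b]
      by (simp add: commutator_M_apply * v'_def L_mult[OF B_L[OF b]] word_span_E algebra_simps)
  qed (use f d v \<mu>[OF b] \<nu>[OF b] in \<open>auto simp: v'_def intro!: E_add E_comp\<close>)
  moreover have "v' - symbol_deriv \<mu> (mset (b # w)) \<in> word_span (length (b # w) - 1)"
  proof -
    let ?T = "\<lambda>i. M (\<mu> i) \<circ> monomial_op (add_mset b (?I - {#i#}))"
    \<comment> \<open>Deleting a letter of \<open>b # w\<close> deletes either \<open>b\<close> or a
      letter of \<open>w\<close>, and then \<open>b\<close> is kept.\<close>
    have "symbol_deriv \<mu> (mset (b # w)) = (M (\<mu> b) \<circ> monomial_op ?I) + (\<Sum>i\<in>#?I. ?T i)"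
      unfolding symbol_deriv_def
      by (auto intro!: arg_cong2[of _ _ _ _ "(+)"] arg_cong[of _ _ sum_mset] image_mset_cong
          simp: multiset_eq_iff)
    moreover have "b \<circ> v = (b \<circ> (v - symbol_deriv \<mu> ?I)) + (b \<circ> symbol_deriv \<mu> ?I)"
      using v dE by (simp add: comp_diff_right word_span_E)
    moreover have "b \<circ> symbol_deriv \<mu> ?I = (\<Sum>i\<in>#?I. b \<circ> (M (\<mu> i) \<circ> monomial_op (?I - {#i#})))"
      unfolding symbol_deriv_def
      by (intro conjunct1[OF comp_sum_mset_right]) (use \<mu>I IB in auto)
    ultimately have "v' - symbol_deriv \<mu> (mset (b # w)) =
      (b \<circ> (v - symbol_deriv \<mu> ?I)) + (M (\<nu> b) \<circ> v) + (M (\<mu> b) \<circ> (word_op w - monomial_op ?I))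
      + (\<Sum>i\<in>#?I. (b \<circ> (M (\<mu> i) \<circ> monomial_op (?I - {#i#}))) - ?T i)"
      using \<mu>[OF b] w by (simp add: v'_def comp_diff_right sum_mset_subtractf[symmetric])
    moreover have "(b \<circ> (M (\<mu> i) \<circ> monomial_op (?I - {#i#}))) - ?T i \<in> word_span (length w)"
      if i: "i \<in># ?I" for i
    proof -
      let ?J = "?I - {#i#}"
      have size: "Suc (size ?J) = length w"
        using size_Suc_Diff1[OF i] by simp
      \<comment> \<open>Moving \<open>b\<close> past the coefficient and sorting it into the
        monomial both cost only shorter words.\<close>
      have "(b \<circ> (M (\<mu> i) \<circ> monomial_op ?J)) - ?T i =
        (M (b \<cdot> \<mu> i) \<circ> monomial_op ?J) + (M (\<mu> i) \<circ> ((b \<circ> monomial_op ?J) - monomial_op (add_mset b ?J)))"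
        using \<mu>I[OF i] IB[of i] b
        by (intro E_ext) (auto simp: L_mult[OF B_L[OF b]] algebra_simps)
      moreover have "\<dots> \<in> word_span (length w)"
        using comp_monomial_op[OF b IB, of i] size \<mu>I[OF i] IB[of i]
        by (intro word_span_add word_span_M monomial_op_word_span) auto
      ultimately show ?thesis by simp
    qed
    moreover have "b \<circ> (v - symbol_deriv \<mu> ?I) \<in> word_span (length w)"
      using word_span_B_pred[OF v(3) b] .
    moreover have "M (\<nu> b) \<circ> v \<in> word_span (length w)" "M (\<mu> b) \<circ> (word_op w - monomial_op ?I) \<in> word_span (length w)"
      using word_span_M[OF v(1)] word_span_M[OF word_op_minus_monomial_op[OF w]] \<mu>[OF b] \<nu>[OF b] by auto
    moreover have "length (b # w) - 1 = length w" by simp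
    ultimately show ?thesis by (simp only: word_span_add word_span_sum_mset)
  qed
  ultimately show ?case by blast
qed

text \<open>The two instances are \<open>(f, 1)\<close> and \<open>(Q, Q)\<close>. In the second one \<open>[u, Q] / Q\<close> replaces the commutator
  of \<open>u\<close> with \<open>log Q\<close>.\<close>

definition log_pair :: "('v \<Rightarrow> 'k) \<Rightarrow> ('v \<Rightarrow> 'k) \<Rightarrow> ((('v \<Rightarrow> 'k) \<Rightarrow> 'v \<Rightarrow> 'k) \<Rightarrow> 'v \<Rightarrow> 'k) \<Rightarrow> bool" where
  "log_pair f d \<mu> \<longleftrightarrow> f \<in> S \<and> d \<in> S \<and> (\<forall>b\<in>B. \<mu> b \<in> S \<and> b \<cdot> f = d * \<mu> b) \<and>
     (\<forall>b\<in>B. \<exists>h\<in>S. b \<cdot> d = d * h)"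

lemma log_pair_word_op_commutator:
  assumes "log_pair f d \<mu>" "set w \<subseteq> B"
  shows "\<exists>v\<in>word_span (length w). commutator (word_op w) (M f) = M d \<circ> v \<and>
    v - symbol_deriv \<mu> (mset w) \<in> word_span (length w - 1)"
proof -
  have "\<forall>b\<in>B. \<exists>h. h \<in> S \<and> b \<cdot> d = d * h" using assms(1) unfolding log_pair_def by blast
  then obtain \<nu> where \<nu>: "\<forall>b\<in>B. \<nu> b \<in> S \<and> b \<cdot> d = d * \<nu> b"
    using bchoice[of B "\<lambda>b h. h \<in> S \<and> b \<cdot> d = d * h"] by blast
  show ?thesis
    by (rule word_op_commutator[where \<nu> = \<nu>]) (use \<nu> assms in \<open>auto simp: log_pair_def\<close>)
qed

lemma monomial_op_commutator:
  assumes "log_pair f d \<mu>" "set_mset I \<subseteq> B"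
  shows "\<exists>v\<in>word_span (size I). commutator (monomial_op I) (M f) = M d \<circ> v \<and>
    v - symbol_deriv \<mu> I \<in> word_span (size I - 1)"
proof -
  obtain w where w: "mset w = I" "monomial_op I = word_op w" using monomial_op_eq_word_op by blast
  then have "set w \<subseteq> B" using assms by auto
  from log_pair_word_op_commutator[OF assms(1) this] show ?thesis using w by auto
qed

text \<open>Coefficients commute with \<open>f\<close> and with \<open>d\<close>, so only the words
  contribute, and each loses a letter.\<close>

lemma word_span_commutator:
  assumes fd: "log_pair f d \<mu>" and r: "r \<in> word_span (Suc q)"
  shows "\<exists>v\<in>word_span q. commutator r (M f) = M d \<circ> v"
  using r
proof induction
  case zero
  have "commutator 0 (M f) = M d \<circ> 0" using fd by (simp add: commutator_eq log_pair_def)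
  then show ?case using word_span.zero by blast
next
  case (add_term r g w)
  then obtain v where v: "v \<in> word_span q" "commutator r (M f) = M d \<circ> v" by blast
  obtain v' where v': "v' \<in> word_span (length w)" "commutator (word_op w) (M f) = M d \<circ> v'"
    using log_pair_word_op_commutator[OF fd add_term.hyps(3)] by blast
  have f: "f \<in> S" and d: "d \<in> S" using fd by (auto simp: log_pair_def)
  note rE = word_span_E[OF add_term.hyps(1)] and wE = word_op_E[OF add_term.hyps(3)]
  have "commutator (r + (M g \<circ> word_op w)) (M f) = M d \<circ> (v + (M g \<circ> v'))" (is "?l = ?r")
  proof (rule E_ext)
    fix h assume h: "h \<in> S"
    have "commutator r (M f) \<cdot> h = d * (v \<cdot> h)" "commutator (word_op w) (M f) \<cdot> h = d * (v' \<cdot> h)"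
      using v v' h by (auto simp: word_span_E)
    then have "r \<cdot> (f * h) = d * (v \<cdot> h) + f * (r \<cdot> h)"
      "word_op w \<cdot> (f * h) = d * (v' \<cdot> h) + f * (word_op w \<cdot> h)"
      using f h rE wE by (auto simp: commutator_M_apply algebra_simps)
    then show "?l \<cdot> h = ?r \<cdot> h"
      using f d h rE wE v v' add_term.hyps by (simp add: commutator_M_apply word_span_E algebra_simps)
  qed (use rE wE f d v v' add_term.hyps in \<open>auto intro!: E_add E_comp E_commutator\<close>)
  moreover have "v + (M g \<circ> v') \<in> word_span q"
  proof (rule word_span_add[OF _ v(1)])
    show "M g \<circ> v' \<in> word_span q"
      by (rule word_span_mono[OF word_span_M[OF v'(1)]]) (use add_term.hyps in auto)
  qed
  ultimately show ?case by blast
qed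

text \<open>\<open>c I\<close> is the coefficient of the monomial \<open>y^I\<close> in the symbol
  of degree \<open>p\<close>; multisets over \<open>B\<close> serve as exponents. All
  \<open>c I\<close> may vanish, so \<open>p\<close> only bounds the word length from above.\<close>

definition leading_coeffs :: "nat \<Rightarrow> (('v \<Rightarrow> 'k) \<Rightarrow> 'v \<Rightarrow> 'k) \<Rightarrow> ((('v \<Rightarrow> 'k) \<Rightarrow> 'v \<Rightarrow> 'k) multiset \<Rightarrow> 'v \<Rightarrow> 'k) \<Rightarrow> bool" where
  "leading_coeffs p v c \<longleftrightarrow> (\<forall>I. c I \<in> S) \<and> finite {I. c I \<noteq> 0} \<and>
     (\<forall>I. c I \<noteq> 0 \<longrightarrow> size I = p \<and> set_mset I \<subseteq> B) \<and>
     v - (\<Sum>I | c I \<noteq> 0. M (c I) \<circ> monomial_op I) \<in> word_span p"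

lemma sum_support:
  assumes "finite K" "{I. c I \<noteq> 0} \<subseteq> K"
  shows "(\<Sum>I | c I \<noteq> 0. M (c I) \<circ> monomial_op I) = (\<Sum>I\<in>K. M (c I) \<circ> monomial_op I)"
  using assms by (intro sum.mono_neutral_left) auto

lemma leading_coeffs_exist: "v \<in> word_span (Suc p) \<Longrightarrow> \<exists>c. leading_coeffs p v c"
proof (induction rule: word_span.induct)
  case zero
  have "leading_coeffs p 0 (\<lambda>I. 0)" by (simp add: leading_coeffs_def word_span.zero)
  then show ?case by blast
next
  case (add_term v f w)
  then obtain c where c: "leading_coeffs p v c" by blast
  let ?s = "\<Sum>I | c I \<noteq> 0. M (c I) \<circ> monomial_op I"
  show ?case
  proof (cases "length w < p")
    case True
    have "(v - ?s) + (M f \<circ> word_op w) \<in> word_span p"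
      using c True add_term.hyps by (intro word_span.add_term) (auto simp: leading_coeffs_def)
    then have "leading_coeffs p (v + (M f \<circ> word_op w)) c"
      using c by (simp add: leading_coeffs_def diff_add_eq)
    then show ?thesis by blast
  next
    case False
    then have len: "length w = p" using add_term.hyps by simp
    define c' where "c' I = c I + (if I = mset w then f else 0)" for I
    \<comment> \<open>The new coefficient at \<open>mset w\<close> may cancel, so the sums are
      compared over an index set that contains both supports.\<close>
    define K where "K = insert (mset w) {I. c I \<noteq> 0}"
    have K: "finite K" "{I. c I \<noteq> 0} \<subseteq> K" "{I. c' I \<noteq> 0} \<subseteq> K" "mset w \<in> K"
      using c by (auto simp: K_def c'_def leading_coeffs_def)
    have cS: "c I \<in> S" for I using c by (auto simp: leading_coeffs_def)
    have "(\<Sum>I\<in>K. M (c' I) \<circ> monomial_op I) =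
        (\<Sum>I\<in>K. (M (c I) \<circ> monomial_op I) + (if I = mset w then M f \<circ> monomial_op (mset w) else 0))"
      using cS add_term.hyps by (intro sum.cong) (auto simp: c'_def M_add comp_add_left)
    also have "\<dots> = ?s + (M f \<circ> monomial_op (mset w))"
      using K by (simp add: sum.distrib sum_support[OF K(1,2)])
    finally have "(\<Sum>I | c' I \<noteq> 0. M (c' I) \<circ> monomial_op I) = ?s + (M f \<circ> monomial_op (mset w))"
      using sum_support[OF K(1,3)] by simp
    moreover have "(v + (M f \<circ> word_op w)) - (?s + (M f \<circ> monomial_op (mset w)))
        = (v - ?s) + (M f \<circ> (word_op w - monomial_op (mset w)))"
      using add_term.hyps by (subst comp_diff_right) auto
    moreover have "\<dots> \<in> word_span p"
      using c word_op_minus_monomial_op[of w] add_term.hyps len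
      by (intro word_span_add word_span_M) (auto simp: leading_coeffs_def)
    ultimately have "(v + (M f \<circ> word_op w)) - (\<Sum>I | c' I \<noteq> 0. M (c' I) \<circ> monomial_op I) \<in> word_span p"
      by (simp only:)
    moreover have "c' I \<in> S" for I using cS add_term.hyps by (auto simp: c'_def)
    moreover have "finite {I. c' I \<noteq> 0}" using K finite_subset by blast
    moreover have "size I = p \<and> set_mset I \<subseteq> B" if "c' I \<noteq> 0" for I
      using that c len add_term.hyps by (auto simp: c'_def leading_coeffs_def split: if_splits)
    ultimately have "leading_coeffs p (v + (M f \<circ> word_op w)) c'" unfolding leading_coeffs_def by blast
    then show ?thesis by blast
  qed
qed

lemma sum_mset_eq_sum_count:
  "(\<Sum>i\<in>#I. M (g i) \<circ> k i) = (\<Sum>i\<in>set_mset I. M (of_nat (count I i) * g i) \<circ> k i)"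
  if "\<And>i. i \<in># I \<Longrightarrow> g i \<in> S"
  using that
proof (induction I)
  case (add x I)
  let ?t = "\<lambda>I i. M (of_nat (count I i) * g i) \<circ> k i"
  have gS: "g i \<in> S" if "i \<in># add_mset x I" for i using add.prems that by blast
  have "(\<Sum>i\<in>set_mset (add_mset x I). ?t (add_mset x I) i) =
      (\<Sum>i\<in>set_mset (add_mset x I). ?t I i + (if i = x then M (g x) \<circ> k x else 0))"
  proof (rule sum.cong[OF refl])
    fix i assume "i \<in># add_mset x I"
    from gS[OF this] show "?t (add_mset x I) i = ?t I i + (if i = x then M (g x) \<circ> k x else 0)"
      by (auto simp: distrib_right M_add comp_add_left add.commute)
  qed
  also have "\<dots> = (\<Sum>i\<in>set_mset (add_mset x I). ?t I i) + (M (g x) \<circ> k x)"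
    by (subst sum.distrib, subst sum.delta) auto
  also have "(\<Sum>i\<in>set_mset (add_mset x I). ?t I i) = (\<Sum>i\<in>set_mset I. ?t I i)"
    by (rule sum.mono_neutral_right) (auto simp: not_in_iff)
  also have "\<dots> = (\<Sum>i\<in>#I. M (g i) \<circ> k i)"
    using add.IH add.prems by simp
  finally show ?case by (simp add: add.commute)
qed simp

text \<open>The derivative of \<open>y^(J + i)\<close> by \<open>y_i\<close> is
  \<open>(J_i + 1) y^J\<close>, so the coefficients in the conclusion are those of the symbol
  differentiated along \<open>\<mu>\<close>. The set \<open>F\<close> contains the letters that
  occur and keeps the sum finite even if \<open>B\<close> is infinite.\<close>

lemma leading_coeffs_commutator:
  assumes v: "leading_coeffs (Suc q) v c" and fd: "log_pair f d \<mu>"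
    and F: "finite F" "F \<subseteq> B" "\<And>I. c I \<noteq> 0 \<Longrightarrow> set_mset I \<subseteq> F"
  shows "\<exists>v'. v' \<in> E \<and> commutator v (M f) = M d \<circ> v' \<and>
    leading_coeffs q v' (\<lambda>J. \<Sum>i\<in>F. of_nat (Suc (count J i)) * c (add_mset i J) * \<mu> i)"
proof -
  define a where "a J = (\<Sum>i\<in>F. of_nat (Suc (count J i)) * c (add_mset i J) * \<mu> i)" for J
  define K where "K = {I. c I \<noteq> 0}"
  have K: "finite K" and cS: "c I \<in> S" for I using v by (auto simp: leading_coeffs_def K_def)
  have KB: "set_mset I \<subseteq> F" "set_mset I \<subseteq> B" "size I = Suc q" if "I \<in> K" for I
    using v that F(3) by (auto simp: leading_coeffs_def K_def)
  have f: "f \<in> S" and d: "d \<in> S" and \<mu>: "\<And>b. b \<in> B \<Longrightarrow> \<mu> b \<in> S"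
    using fd by (auto simp: log_pair_def)
  \<comment> \<open>The words of the remainder have at most \<open>q\<close> letters, so those of
    its commutator after division by \<open>d\<close> have fewer than \<open>q\<close> and do not
    affect the new symbol.\<close>
  define r where "r = v - (\<Sum>I\<in>K. M (c I) \<circ> monomial_op I)"
  have r: "r \<in> word_span (Suc q)" using v by (simp add: leading_coeffs_def r_def K_def)
  obtain r' where r': "r' \<in> word_span q" "commutator r (M f) = M d \<circ> r'"
    using word_span_commutator[OF fd r] by blast
  have "\<forall>I\<in>K. \<exists>n. n \<in> word_span (Suc q) \<and> commutator (monomial_op I) (M f) = M d \<circ> n \<and>
      n - symbol_deriv \<mu> I \<in> word_span q"
  proof
    fix I assume "I \<in> K"
    from monomial_op_commutator[OF fd KB(2)[OF this], unfolded KB(3)[OF this]]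
    show "\<exists>n. n \<in> word_span (Suc q) \<and> commutator (monomial_op I) (M f) = M d \<circ> n \<and>
        n - symbol_deriv \<mu> I \<in> word_span q"
      by (simp only: diff_Suc_1 Bex_def)
  qed
  from bchoice[OF this] obtain n where n: "\<And>I. I \<in> K \<Longrightarrow> n I \<in> word_span (Suc q)"
    "\<And>I. I \<in> K \<Longrightarrow> commutator (monomial_op I) (M f) = M d \<circ> n I"
    "\<And>I. I \<in> K \<Longrightarrow> n I - symbol_deriv \<mu> I \<in> word_span q" by blast
  define v' where "v' = r' + (\<Sum>I\<in>K. M (c I) \<circ> n I)"
  have v_eq: "v = r + (\<Sum>I\<in>K. M (c I) \<circ> monomial_op I)" by (simp add: r_def)
  have nE: "n I \<in> E" if "I \<in> K" for I using n(1)[OF that] by (rule word_span_E)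
  have v'E: "v' \<in> E"
    unfolding v'_def using nE cS r'(1) by (intro E_add E_sum E_comp) auto
  have vE: "v \<in> E"
    unfolding v_eq using KB cS r by (intro E_add E_sum E_comp) auto
  have "commutator v (M f) = M d \<circ> v'"
  proof (rule E_ext)
    fix h assume h: "h \<in> S"
    have "commutator r (M f) \<cdot> h = d * (r' \<cdot> h)" using r' h by (simp add: word_span_E)
    then have 1: "r \<cdot> (f * h) = d * (r' \<cdot> h) + f * (r \<cdot> h)"
      using f h r by (simp add: commutator_M_apply word_span_E algebra_simps)
    have 2: "monomial_op I \<cdot> (f * h) = d * (n I \<cdot> h) + f * (monomial_op I \<cdot> h)" if "I \<in> K" for I
    proof -
      have "commutator (monomial_op I) (M f) \<cdot> h = d * (n I \<cdot> h)" using n(2)[OF that] nE[OF that] h by simp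
      then show ?thesis
        using f h KB[OF that] by (simp add: commutator_M_apply algebra_simps)
    qed
    have "commutator v (M f) \<cdot> h = v \<cdot> (f * h) - f * (v \<cdot> h)"
      using vE h by (simp add: commutator_M_apply)
    also have "v \<cdot> (f * h) = r \<cdot> (f * h) + (\<Sum>I\<in>K. c I * (monomial_op I \<cdot> (f * h)))"
      using KB unfolding v_eq by (simp cong: sum.cong)
    also have "v \<cdot> h = r \<cdot> h + (\<Sum>I\<in>K. c I * (monomial_op I \<cdot> h))"
      using KB unfolding v_eq by (simp cong: sum.cong)
    finally have "commutator v (M f) \<cdot> h = d * (r' \<cdot> h) + (\<Sum>I\<in>K. c I * (d * (n I \<cdot> h)))"
      using 1 2 by (simp add: algebra_simps sum.distrib sum_distrib_left cong: sum.cong)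
    also have "\<dots> = (M d \<circ> v') \<cdot> h"
      using nE h cS word_span_E[OF r'(1)] by (simp add: v'_def algebra_simps sum_distrib_left cong: sum.cong)
    finally show "commutator v (M f) \<cdot> h = (M d \<circ> v') \<cdot> h" .
  qed (use vE v'E f d in auto)
  moreover have "leading_coeffs q v' a"
  proof -
    \<comment> \<open>The exponents obtained from the support by deleting one letter.\<close>
    define K' where "K' = (\<lambda>(I, i). I - {#i#}) ` Sigma K set_mset"
    have aS: "a J \<in> S" for J unfolding a_def using F \<mu> cS by (intro S_sum S_mult) auto
    have K': "finite K'" unfolding K'_def using K by (intro finite_imageI finite_SigmaI) auto
    have supp: "J \<in> K'" if nz: "c (add_mset i J) \<noteq> 0" for i J
      unfolding K'_def by (rule image_eqI[of _ _ "(add_mset i J, i)"]) (use nz in \<open>auto simp: K_def\<close>)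
    have aK': "J \<in> K'" if "a J \<noteq> 0" for J
    proof -
      from that obtain i where "of_nat (Suc (count J i)) * c (add_mset i J) * \<mu> i \<noteq> 0"
        unfolding a_def using sum.neutral by meson
      then have "c (add_mset i J) \<noteq> 0" by auto
      then show ?thesis by (rule supp)
    qed
    have J: "size J = q \<and> set_mset J \<subseteq> B" if "J \<in> K'" for J
    proof -
      obtain I i where I: "I \<in> K" "i \<in># I" "J = I - {#i#}" using \<open>J \<in> K'\<close> by (auto simp: K'_def)
      then show ?thesis using KB[OF I(1)] by (auto simp: size_Diff_singleton dest: in_diffD)
    qed
    have "(\<Sum>I\<in>K. M (c I) \<circ> symbol_deriv \<mu> I) =
        (\<Sum>I\<in>K. \<Sum>i\<in>set_mset I. M (of_nat (count I i) * c I * \<mu> i) \<circ> monomial_op (I - {#i#}))"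
    proof (rule sum.cong[OF refl])
      fix I assume I: "I \<in> K"
      have JB: "set_mset (I - {#i#}) \<subseteq> B" for i using KB(2)[OF I] by (fastforce dest: in_diffD)
      have \<mu>S: "\<mu> i \<in> S" if "i \<in># I" for i using KB(2)[OF I] \<mu> that by blast
      have "symbol_deriv \<mu> I = (\<Sum>i\<in>set_mset I. M (of_nat (count I i) * \<mu> i) \<circ> monomial_op (I - {#i#}))"
        unfolding symbol_deriv_def using \<mu>S by (rule sum_mset_eq_sum_count)
      then have "M (c I) \<circ> symbol_deriv \<mu> I =
          (\<Sum>i\<in>set_mset I. M (c I) \<circ> (M (of_nat (count I i) * \<mu> i) \<circ> monomial_op (I - {#i#})))"
        using \<mu>S JB cS by (simp add: comp_sum_right)
      also have "\<dots> = (\<Sum>i\<in>set_mset I. M (of_nat (count I i) * c I * \<mu> i) \<circ> monomial_op (I - {#i#}))"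
        using \<mu>S cS by (intro sum.cong) (auto simp: M_comp' mult_ac)
      finally show "M (c I) \<circ> symbol_deriv \<mu> I = \<dots>" .
    qed
    also have "\<dots> = (\<Sum>(I, i)\<in>Sigma K set_mset. M (of_nat (count I i) * c I * \<mu> i) \<circ> monomial_op (I - {#i#}))"
      using K by (subst sum.Sigma) auto
    \<comment> \<open>The sum over monomials \<open>I\<close> with a deleted letter \<open>i\<close>
      is reindexed by the result \<open>J\<close>. Pairs with \<open>add_mset i J\<close> outside
      the support contribute zero.\<close>
    also have "\<dots> = (\<Sum>(J, i)\<in>K' \<times> F. M (of_nat (Suc (count J i)) * c (add_mset i J) * \<mu> i) \<circ> monomial_op J)"
    proof (rule sum.reindex_bij_witness_not_neutral[where S' = "{}"
          and T' = "{(J, i) \<in> K' \<times> F. c (add_mset i J) = 0}"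
          and i = "\<lambda>(J, i). (add_mset i J, i)" and j = "\<lambda>(I, i). (I - {#i#}, i)"])
      show "finite {(J, i) \<in> K' \<times> F. c (add_mset i J) = 0}"
        by (rule finite_subset[of _ "K' \<times> F"]) (use K' F in auto)
    next
      fix x assume x: "x \<in> Sigma K set_mset - {}"
      then obtain I i where I: "x = (I, i)" "I \<in> K" "i \<in># I" by auto
      then have "I - {#i#} \<in> K'" unfolding K'_def by (intro image_eqI[of _ _ x]) auto
      moreover have "add_mset i (I - {#i#}) = I" "c I \<noteq> 0" "i \<in> F"
        using I KB(1) by (auto simp: insert_DiffM K_def)
      ultimately show "(case x of (I, i) \<Rightarrow> (I - {#i#}, i)) \<in> K' \<times> F - {(J, i) \<in> K' \<times> F. c (add_mset i J) = 0}"
        using I by simp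
    qed (auto simp: K_def insert_DiffM split: prod.splits simp del: of_nat_Suc)
    also have "\<dots> = (\<Sum>J\<in>K'. \<Sum>i\<in>F. M (of_nat (Suc (count J i)) * c (add_mset i J) * \<mu> i) \<circ> monomial_op J)"
      using K' F by (subst sum.cartesian_product) auto
    also have "\<dots> = (\<Sum>J\<in>K'. M (a J) \<circ> monomial_op J)"
      unfolding a_def using F \<mu> cS
      by (intro sum.cong) (auto simp: M_sum comp_sum_left subsetD simp del: of_nat_Suc)
    also have "\<dots> = (\<Sum>J | a J \<noteq> 0. M (a J) \<circ> monomial_op J)"
      using K' aK' by (subst sum_support[of K']) auto
    finally have "v' - (\<Sum>J | a J \<noteq> 0. M (a J) \<circ> monomial_op J) = v' - (\<Sum>I\<in>K. M (c I) \<circ> symbol_deriv \<mu> I)"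
      by simp
    also have "\<dots> = r' + (\<Sum>I\<in>K. (M (c I) \<circ> n I) - (M (c I) \<circ> symbol_deriv \<mu> I))"
      by (simp add: v'_def sum_subtractf)
    also have "\<dots> = r' + (\<Sum>I\<in>K. M (c I) \<circ> (n I - symbol_deriv \<mu> I))"
    proof (intro arg_cong2[of _ _ _ _ "(+)"] sum.cong refl)
      fix I assume I: "I \<in> K"
      have "symbol_deriv \<mu> I \<in> E"
        using word_span_E[OF symbol_deriv_word_span[OF KB(2)[OF I] \<mu>]] .
      then show "(M (c I) \<circ> n I) - (M (c I) \<circ> symbol_deriv \<mu> I) = M (c I) \<circ> (n I - symbol_deriv \<mu> I)"
        using cS nE[OF I] by (simp add: comp_diff_right)
    qed
    also have "\<dots> \<in> word_span q"
      using r' n(3) cS by (intro word_span_add word_span_sum word_span_M) auto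
    finally have "v' - (\<Sum>J | a J \<noteq> 0. M (a J) \<circ> monomial_op J) \<in> word_span q" .
    moreover have "finite {J. a J \<noteq> 0}" by (rule finite_subset[OF _ K']) (use aK' in auto)
    ultimately show ?thesis using aS aK' J unfolding leading_coeffs_def by blast
  qed
  ultimately show ?thesis using v'E unfolding a_def by blast
qed

subsection \<open>Tangent operators\<close>

abbreviation "T \<equiv> tangent_diff_ops scale Q"

lemma T_iff: "u \<in> T \<longleftrightarrow> u \<in> diff_ops scale \<and>
  (\<forall>t\<ge>1. \<forall>w\<in>diff_ops scale. \<exists>w'\<in>diff_ops scale. u \<circ> (M (Q ^ t) \<circ> w) = M (Q ^ t) \<circ> w')"
proof -
  have 1: "u \<in> idealizer scale {M (Q ^ t) \<circ> w |w. w \<in> diff_ops scale} \<longleftrightarrow> u \<in> diff_ops scale \<and>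
     (\<forall>w\<in>diff_ops scale. \<exists>w'\<in>diff_ops scale. u \<circ> (M (Q ^ t) \<circ> w) = M (Q ^ t) \<circ> w')" for t
    unfolding idealizer_def by blast
  have 2: "u \<in> T \<longleftrightarrow> (\<forall>t\<ge>1. u \<in> idealizer scale {M (Q ^ t) \<circ> w |w. w \<in> diff_ops scale})"
    unfolding tangent_diff_ops_def by auto
  have 3: "(\<forall>t\<ge>1. A \<and> P t) \<longleftrightarrow> A \<and> (\<forall>t\<ge>1. P t)" for A and P :: "nat \<Rightarrow> bool"
    by auto
  show ?thesis unfolding 2 1 by (rule 3)
qed

lemma T_diff_ops: "u \<in> T \<Longrightarrow> u \<in> diff_ops scale"
  by (simp add: T_iff)

lemma T_E: "u \<in> T \<Longrightarrow> u \<in> E"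
  by (rule diff_ops_E[OF T_diff_ops])

lemma T_D:
  assumes "u \<in> T" "t \<ge> 1" "w \<in> diff_ops scale"
  obtains w' where "w' \<in> diff_ops scale" "u \<circ> (M (Q ^ t) \<circ> w) = M (Q ^ t) \<circ> w'"
  using assms unfolding T_iff by blast

lemma T_I:
  assumes "u \<in> diff_ops scale"
    "\<And>t w. t \<ge> 1 \<Longrightarrow> w \<in> diff_ops scale \<Longrightarrow>
      \<exists>w'\<in>diff_ops scale. u \<circ> (M (Q ^ t) \<circ> w) = M (Q ^ t) \<circ> w'"
  shows "u \<in> T"
  using assms unfolding T_iff by blast

lemma T_M: "f \<in> S \<Longrightarrow> M f \<in> T"
proof (rule T_I)
  fix t and w assume f: "f \<in> S" and w: "w \<in> diff_ops scale"
  then have "M f \<circ> (M (Q ^ t) \<circ> w) = M (Q ^ t) \<circ> (M f \<circ> w)"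
    by (simp add: M_comp' mult.commute)
  then show "\<exists>w'\<in>diff_ops scale. M f \<circ> (M (Q ^ t) \<circ> w) = M (Q ^ t) \<circ> w'"
    using diff_ops_comp[OF diff_ops_M[OF f] w] by blast
qed (rule diff_ops_M)

lemma T_add:
  assumes "u \<in> T" "v \<in> T"
  shows "u + v \<in> T"
proof (rule T_I)
  fix t :: nat and w assume tw: "t \<ge> 1" "w \<in> diff_ops scale"
  obtain u' where u': "u' \<in> diff_ops scale" "u \<circ> (M (Q ^ t) \<circ> w) = M (Q ^ t) \<circ> u'"
    using T_D[OF assms(1) tw] .
  obtain v' where v': "v' \<in> diff_ops scale" "v \<circ> (M (Q ^ t) \<circ> w) = M (Q ^ t) \<circ> v'"
    using T_D[OF assms(2) tw] .
  have "(u + v) \<circ> (M (Q ^ t) \<circ> w) = M (Q ^ t) \<circ> (u' + v')"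
    using u' v' by (simp add: comp_add_left comp_add_right diff_ops_E)
  then show "\<exists>w'\<in>diff_ops scale. (u + v) \<circ> (M (Q ^ t) \<circ> w) = M (Q ^ t) \<circ> w'"
    using diff_ops_add[OF u'(1) v'(1)] by blast
qed (rule diff_ops_add[OF assms[THEN T_diff_ops]])

lemma T_comp:
  assumes "u \<in> T" "v \<in> T"
  shows "u \<circ> v \<in> T"
proof (rule T_I)
  fix t :: nat and w assume tw: "t \<ge> 1" "w \<in> diff_ops scale"
  obtain v' where v': "v' \<in> diff_ops scale" "v \<circ> (M (Q ^ t) \<circ> w) = M (Q ^ t) \<circ> v'"
    using T_D[OF assms(2) tw] .
  obtain u' where u': "u' \<in> diff_ops scale" "u \<circ> (M (Q ^ t) \<circ> v') = M (Q ^ t) \<circ> u'"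
    using T_D[OF assms(1) tw(1) v'(1)] .
  have "(u \<circ> v) \<circ> (M (Q ^ t) \<circ> w) = M (Q ^ t) \<circ> u'"
    by (simp only: comp_assoc v'(2) u'(2))
  then show "\<exists>w'\<in>diff_ops scale. (u \<circ> v) \<circ> (M (Q ^ t) \<circ> w) = M (Q ^ t) \<circ> w'"
    using u'(1) by blast
qed (rule diff_ops_comp[OF assms[THEN T_diff_ops]])

lemma T_diff: "u \<in> T \<Longrightarrow> v \<in> T \<Longrightarrow> u - v \<in> T"
proof -
  assume u: "u \<in> T" and v: "v \<in> T"
  have "u - v = u + (M (- 1) \<circ> v)" using T_E[OF u] T_E[OF v] by (intro E_ext) auto
  also have "\<dots> \<in> T" by (intro T_add T_comp T_M u v) auto
  finally show ?thesis .
qed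

text \<open>As operators, \<open>\<delta> Q^t = Q^t (\<delta> + t h)\<close> when
  \<open>\<delta>\<close> maps \<open>Q\<close> to \<open>Q h\<close>.\<close>

lemma L_subset_T:
  assumes "\<delta> \<in> L"
  shows "\<delta> \<in> T"
proof (rule T_I)
  have \<delta>: "\<delta> \<in> derivations scale" using assms by (simp add: L_iff)
  then show d: "\<delta> \<in> diff_ops scale" by (rule diff_ops_derivation)
  fix t :: nat and w assume tw: "t \<ge> 1" "w \<in> diff_ops scale"
  obtain h where h: "h \<in> S" "\<delta> \<cdot> Q = Q * h" using assms by (auto simp: L_iff)
  obtain n where n: "t = Suc n" using tw(1) by (cases t) auto
  have eq: "\<delta> \<cdot> (Q ^ t) = Q ^ t * (of_nat t * h)"
    unfolding n derivation_power[OF \<delta> Q_S] h(2) by (simp add: mult_ac del: of_nat_Suc)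
  have "\<delta> \<circ> (M (Q ^ t) \<circ> w) = M (Q ^ t) \<circ> ((\<delta> \<circ> w) + (M (of_nat t * h) \<circ> w))"
    using tw(2) h L_E[OF assms] diff_ops_E
    by (intro E_ext) (auto simp: L_mult[OF assms] eq algebra_simps)
  moreover have "(\<delta> \<circ> w) + (M (of_nat t * h) \<circ> w) \<in> diff_ops scale"
    using d tw(2) h by (intro diff_ops_add diff_ops_comp diff_ops_M) auto
  ultimately show "\<exists>w'\<in>diff_ops scale. \<delta> \<circ> (M (Q ^ t) \<circ> w) = M (Q ^ t) \<circ> w'" by blast
qed

text \<open>Tangency for \<open>t = 1\<close>, applied to the identity, provides
  \<open>u' = Q^-1 u Q\<close> as an operator on \<open>S\<close>. Tangency of \<open>u\<close> for
  \<open>t + 1\<close>, after cancelling one \<open>Q\<close>, is tangency of \<open>u'\<close> for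
  \<open>t\<close>.\<close>

lemma T_conjugate:
  assumes u: "u \<in> T"
  shows "\<exists>u'\<in>T. u \<circ> M Q = M Q \<circ> u'"
proof -
  have M1: "M 1 \<in> diff_ops scale" by (rule diff_ops_M) auto
  obtain u' where u': "u' \<in> diff_ops scale" "u \<circ> (M (Q ^ 1) \<circ> M 1) = M (Q ^ 1) \<circ> u'"
    using T_D[OF u order_refl M1] .
  then have eq: "u \<circ> M Q = M Q \<circ> u'" by (simp add: M_comp)
  have "u' \<in> T"
  proof (rule T_I[OF u'(1)])
    fix t :: nat and w assume w: "w \<in> diff_ops scale"
    obtain w' where w': "w' \<in> diff_ops scale" "u \<circ> (M (Q ^ Suc t) \<circ> w) = M (Q ^ Suc t) \<circ> w'"
      using T_D[OF u _ w, of "Suc t"] by auto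
    have split: "M (Q ^ Suc t) \<circ> z = M Q \<circ> (M (Q ^ t) \<circ> z)" for z by (simp add: M_comp')
    have "M Q \<circ> (u' \<circ> (M (Q ^ t) \<circ> w)) = u \<circ> M Q \<circ> (M (Q ^ t) \<circ> w)"
      by (simp only: eq comp_assoc)
    also have "\<dots> = M Q \<circ> (M (Q ^ t) \<circ> w')"
      using w'(2) by (simp only: comp_assoc split)
    finally have "u' \<circ> (M (Q ^ t) \<circ> w) = M (Q ^ t) \<circ> w'"
      by (rule M_cancel[OF Q_S Q_nonzero, rotated 2])
        (use u'(1)[THEN diff_ops_E] w[THEN diff_ops_E] w'(1)[THEN diff_ops_E] in auto)
    then show "\<exists>w'\<in>diff_ops scale. u' \<circ> (M (Q ^ t) \<circ> w) = M (Q ^ t) \<circ> w'" using w'(1) by blast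
  qed
  with eq show ?thesis by blast
qed

lemma T_commutator_Q:
  assumes "u \<in> T"
  shows "\<exists>u'\<in>T. commutator u (M Q) = M Q \<circ> u'"
proof -
  obtain u' where u': "u' \<in> T" "u \<circ> M Q = M Q \<circ> u'" using T_conjugate[OF assms] by blast
  then have "commutator u (M Q) = M Q \<circ> (u' - u)"
    using T_E assms by (simp add: commutator_eq comp_diff_right)
  then show ?thesis using T_diff[OF u'(1) assms] by blast
qed

lemma T_commutator: "u \<in> T \<Longrightarrow> f \<in> S \<Longrightarrow> commutator u (M f) \<in> T"
  by (simp add: commutator_eq T_diff T_comp T_M)

subsection \<open>Divisibility of leading coefficients\<close>

text \<open>All values of the derivation with coefficients \<open>s\<close> are divisible by
  \<open>a\<close>, so its quotient by \<open>a\<close> is a derivation of \<open>S\<close>, and by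
  \<open>divQ\<close> a tangent one. Expanding the quotient in the basis and comparing coefficients
  gives the claim. \<open>divQ\<close> is a separate condition because \<open>a\<close> may share
  factors with \<open>Q\<close>, for instance be a power of it.\<close>

lemma basis_coefficients_divisible:
  assumes F: "finite F" "F \<subseteq> B" "\<And>b. b \<in> F \<Longrightarrow> s b \<in> S" and a: "a \<in> S" "a \<noteq> 0"
    and div: "\<And>f. f \<in> S \<Longrightarrow> \<exists>h\<in>S. (\<Sum>b\<in>F. s b * (b \<cdot> f)) = a * h"
    and divQ: "\<exists>h\<in>S. (\<Sum>b\<in>F. s b * (b \<cdot> Q)) = a * (Q * h)"
    and b: "b \<in> F"
  shows "\<exists>h\<in>S. s b = a * h"
proof -
  define \<theta> where "\<theta> = (\<Sum>b\<in>F. M (s b) \<circ> b)"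
  have FE: "b \<in> E" "b \<in> L" if "b \<in> F" for b using that F(2) B_E B_L by auto
  have \<theta>E: "\<theta> \<in> E" unfolding \<theta>_def using FE F(3) by (intro E_sum E_comp) auto
  have \<theta>_apply: "\<theta> \<cdot> f = (\<Sum>b\<in>F. s b * (b \<cdot> f))" if "f \<in> S" for f
    unfolding \<theta>_def using FE by (simp cong: sum.cong)
  \<comment> \<open>The quotient is chosen value by value; cancellation in \<open>S\<close> makes it
    unique, which yields linearity and the Leibniz rule.\<close>
  define \<eta> where "\<eta> f = (if f \<in> S then SOME h. h \<in> S \<and> \<theta> \<cdot> f = a * h else 0)" for f
  have \<eta>: "\<eta> \<cdot> f \<in> S" "\<theta> \<cdot> f = a * (\<eta> \<cdot> f)" if "f \<in> S" for f
    using someI_ex[of "\<lambda>h. h \<in> S \<and> \<theta> \<cdot> f = a * h"] div[OF that] \<theta>_apply[OF that] that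
    by (auto simp: \<eta>_def app_def)
  have \<eta>_eqI: "\<eta> \<cdot> f = h" if "f \<in> S" "h \<in> S" "\<theta> \<cdot> f = a * h" for f h
    using S_cancel[OF a \<eta>(1)[OF that(1)] that(2)] \<eta>(2)[OF that(1)] that(3) by simp
  have \<theta>_mult: "\<theta> \<cdot> (f * g) = f * (\<theta> \<cdot> g) + (\<theta> \<cdot> f) * g" if "f \<in> S" "g \<in> S" for f g
    using that FE(2)
    by (simp add: \<theta>_apply L_mult algebra_simps sum.distrib sum_distrib_left cong: sum.cong)
  have \<eta>E: "\<eta> \<in> E"
  proof (rule E_I)
    show "\<eta> \<cdot> f = 0" if "f \<notin> S" for f using that by (simp add: \<eta>_def app_def)
    show "\<eta> \<cdot> (f + g) = \<eta> \<cdot> f + \<eta> \<cdot> g" if "f \<in> S" "g \<in> S" for f g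
      using that \<eta> \<theta>E by (intro \<eta>_eqI) (auto simp: distrib_left)
    show "\<eta> \<cdot> ((\<lambda>v. c) * f) = (\<lambda>v. c) * (\<eta> \<cdot> f)" if "f \<in> S" for f c
      using that \<eta> \<theta>E S_const by (intro \<eta>_eqI) (auto simp: E_const_arg mult.left_commute)
  qed (rule \<eta>(1))
  have "\<eta> \<in> derivations scale"
  proof (rule derivationsI[OF \<eta>E])
    fix f g assume fg: "f \<in> S" "g \<in> S"
    show "\<eta> \<cdot> (f * g) = f * (\<eta> \<cdot> g) + (\<eta> \<cdot> f) * g"
    proof (rule \<eta>_eqI)
      show "\<theta> \<cdot> (f * g) = a * (f * (\<eta> \<cdot> g) + (\<eta> \<cdot> f) * g)"
        unfolding \<theta>_mult[OF fg] \<eta>(2)[OF fg(1)] \<eta>(2)[OF fg(2)] by (simp add: algebra_simps)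
    qed (use fg \<eta>(1) in auto)
  qed
  moreover obtain h where "h \<in> S" "\<theta> \<cdot> Q = a * (Q * h)" using divQ by (auto simp: \<theta>_apply)
  ultimately have "\<eta> \<in> L" unfolding L_iff using \<eta>_eqI[OF Q_S] by blast
  then obtain F' e where F': "finite F'" "F' \<subseteq> B" "\<And>b. b \<in> F' \<Longrightarrow> e b \<in> S"
    "\<eta> = (\<Sum>b\<in>F'. M (e b) \<circ> b)" using L_spanned by blast
  \<comment> \<open>The two expansions may involve different basis elements, so both are extended by
    zero to a common index set.\<close>
  define H where "H = F \<union> F'"
  have H: "finite H" "H \<subseteq> B" "F \<subseteq> H" "F' \<subseteq> H" using F(1,2) F'(1,2) by (auto simp: H_def)
  define s' where "s' b = (if b \<in> F then s b else 0)" for b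
  define e' where "e' b = (if b \<in> F' then e b else 0)" for b
  have S': "s' b \<in> S" "e' b \<in> S" for b using F(3) F'(3) by (auto simp: s'_def e'_def)
  have GE: "b \<in> E" if "b \<in> H" for b using that H(2) B_E by auto
  have \<theta>': "\<theta> = (\<Sum>b\<in>H. M (s' b) \<circ> b)"
    unfolding \<theta>_def using H by (intro sum.mono_neutral_cong_left) (auto simp: s'_def)
  have \<eta>': "\<eta> = (\<Sum>b\<in>H. M (e' b) \<circ> b)"
    unfolding F'(4) using H by (intro sum.mono_neutral_cong_left) (auto simp: e'_def)
  have "(\<Sum>b\<in>H. M (s' b - a * e' b) \<circ> b) = 0"
  proof (rule E_ext)
    fix f assume f: "f \<in> S"
    have "\<theta> \<cdot> f = (\<Sum>b\<in>H. s' b * (b \<cdot> f))" "\<eta> \<cdot> f = (\<Sum>b\<in>H. e' b * (b \<cdot> f))"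
      unfolding \<theta>' \<eta>' using GE by (simp_all cong: sum.cong)
    then have "(\<Sum>b\<in>H. s' b * (b \<cdot> f)) = a * (\<Sum>b\<in>H. e' b * (b \<cdot> f))"
      using \<eta>(2)[OF f] by simp
    then show "(\<Sum>b\<in>H. M (s' b - a * e' b) \<circ> b) \<cdot> f = 0 \<cdot> f"
      using GE by (simp add: left_diff_distrib sum_subtractf sum_distrib_left mult.assoc cong: sum.cong)
  qed (use GE S' a in \<open>auto intro!: E_sum E_comp\<close>)
  then have "s' b - a * e' b = 0"
    using H S' a b by (intro B_independent[of "H" "\<lambda>b. s' b - a * e' b"]) auto
  then show ?thesis using S' b by (auto simp: s'_def)
qed

text \<open>The induction generalizes over \<open>v\<close>, \<open>c\<close> and \<open>u\<close>,
  since it passes to \<open>[v, f]\<close> and \<open>Q^-1 [v, Q]\<close>. These are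
  \<open>a\<close> times the tangent operators \<open>[u, f]\<close> and
  \<open>Q^-1 [u, Q]\<close>.\<close>

lemma leading_coeffs_divisible:
  assumes "leading_coeffs p v c" "v = M a \<circ> u" "u \<in> T" "a \<in> S" "a \<noteq> 0"
  shows "\<exists>h\<in>S. c I = a * h"
  using assms(1-3)
proof (induction p arbitrary: v c u I)
  case 0
  show ?case
  proof (cases "c I = 0")
    case True
    then show ?thesis by (intro bexI[of _ 0]) auto
  next
    case False
    then have I: "I = {#}" using 0 by (auto simp: leading_coeffs_def)
    \<comment> \<open>In degree zero \<open>v\<close> is multiplication by its only coefficient,
      which evaluation at 1 reads off.\<close>
    have "monomial_op {#} = M 1" using monomial_op_eq_word_op[of "{#}"] by auto
    have "{I. c I \<noteq> 0} \<subseteq> {{#}}" using 0 by (auto simp: leading_coeffs_def)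
    then have "v - (M (c {#}) \<circ> monomial_op {#}) \<in> word_span 0"
      using 0(1) sum_support[of "{{#}}" c] by (simp add: leading_coeffs_def)
    then have "v = M (c {#}) \<circ> M 1" using \<open>monomial_op {#} = M 1\<close> by (simp add: word_span_0)
    then have "v \<cdot> 1 = c {#}" by simp
    moreover have "v \<cdot> 1 = a * (u \<cdot> 1)" using 0 T_E by simp
    ultimately show ?thesis using I T_E[OF 0(3)] by (intro bexI[of _ "u \<cdot> 1"]) auto
  qed
next
  case (Suc q)
  have uE: "u \<in> E" using T_E[OF Suc.prems(3)] .
  show ?case
  proof (cases "c I = 0")
    case True
    then show ?thesis by (intro bexI[of _ 0]) auto
  next
    case False
    define F where "F = (\<Union>I\<in>{I. c I \<noteq> 0}. set_mset I)"
    have F: "finite F" "F \<subseteq> B" "\<And>I. c I \<noteq> 0 \<Longrightarrow> set_mset I \<subseteq> F" and cS: "\<And>I. c I \<in> S"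
      using Suc.prems(1) by (auto simp: F_def leading_coeffs_def)
    have "size I = Suc q" using Suc.prems(1) False by (auto simp: leading_coeffs_def)
    then obtain i J where I: "I = add_mset i J" by (auto dest!: size_eq_Suc_imp_eq_union)
    have i: "i \<in> F" using F(3)[OF False] I by auto
    \<comment> \<open>The coefficient of \<open>y^J\<close> in the derivative of the symbol by
      \<open>y_b\<close>; for \<open>b = i\<close> it is a positive multiple of
      \<open>c I\<close>.\<close>
    define s where "s b = of_nat (Suc (count J b)) * c (add_mset b J)" for b
    have sS: "s b \<in> S" for b unfolding s_def using cS by (intro S_mult) auto
    have BS: "b \<cdot> f \<in> S" if "b \<in> B" for b f using B_E[OF that] by auto
    have "\<exists>h\<in>S. s i = a * h"
    proof (rule basis_coefficients_divisible[OF F(1,2) sS assms(4,5) _ _ i])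
      fix f assume f: "f \<in> S"
      have "log_pair f 1 (\<lambda>b. b \<cdot> f)"
        unfolding log_pair_def using f BS B_L derivation_one L_iff by (auto intro!: bexI[of _ 0])
      from leading_coeffs_commutator[OF Suc.prems(1) this F] obtain v' where v': "v' \<in> E"
        "commutator v (M f) = M 1 \<circ> v'"
        "leading_coeffs q v' (\<lambda>J. \<Sum>i\<in>F. of_nat (Suc (count J i)) * c (add_mset i J) * (i \<cdot> f))"
        by blast
      have "commutator v (M f) = M a \<circ> commutator u (M f)"
        using uE f assms(4) unfolding Suc.prems(2)
        by (intro E_ext) (auto simp: commutator_M_apply algebra_simps)
      then have "v' = M a \<circ> commutator u (M f)" using v' by simp
      from Suc.IH[OF v'(3) this T_commutator[OF Suc.prems(3) f], of J]
      show "\<exists>h\<in>S. (\<Sum>b\<in>F. s b * (b \<cdot> f)) = a * h" by (simp only: s_def)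
    next
      have "\<forall>b\<in>B. \<exists>h. h \<in> S \<and> b \<cdot> Q = Q * h" using B_L L_iff by blast
      then obtain \<mu> where \<mu>: "\<And>b. b \<in> B \<Longrightarrow> \<mu> b \<in> S \<and> b \<cdot> Q = Q * \<mu> b"
        using bchoice[of B "\<lambda>b h. h \<in> S \<and> b \<cdot> Q = Q * h"] by blast
      then have "log_pair Q Q \<mu>" unfolding log_pair_def by blast
      from leading_coeffs_commutator[OF Suc.prems(1) this F] obtain v' where v': "v' \<in> E"
        "commutator v (M Q) = M Q \<circ> v'"
        "leading_coeffs q v' (\<lambda>J. \<Sum>i\<in>F. of_nat (Suc (count J i)) * c (add_mset i J) * \<mu> i)"
        by blast
      obtain u' where u': "u' \<in> T" "commutator u (M Q) = M Q \<circ> u'"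
        using T_commutator_Q[OF Suc.prems(3)] by blast
      have "commutator v (M Q) = M a \<circ> commutator u (M Q)"
        using uE assms(4) unfolding Suc.prems(2)
        by (intro E_ext) (auto simp: commutator_M_apply algebra_simps)
      \<comment> \<open>Cancelling \<open>Q\<close> on both sides exhibits \<open>v'\<close> as
        \<open>a\<close> times a tangent operator, as the induction hypothesis requires.\<close>
      then have "M Q \<circ> v' = M Q \<circ> (M a \<circ> u')"
        using assms(4) by (simp add: v'(2) u'(2) M_comp' mult.commute)
      then have "v' = M a \<circ> u'"
        by (rule M_cancel[OF Q_S Q_nonzero v'(1) E_comp[OF E_M[OF assms(4)] T_E[OF u'(1)]]])
      from Suc.IH[OF v'(3) this u'(1), of J]
      have "\<exists>h\<in>S. (\<Sum>b\<in>F. s b * \<mu> b) = a * h" by (simp only: s_def)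
      then obtain h where h: "h \<in> S" "(\<Sum>b\<in>F. s b * \<mu> b) = a * h" by blast
      have "(\<Sum>b\<in>F. s b * (b \<cdot> Q)) = (\<Sum>b\<in>F. Q * (s b * \<mu> b))"
        using \<mu> F(2) by (intro sum.cong) (auto simp: mult_ac subsetD)
      also have "\<dots> = a * (Q * h)"
        by (simp only: sum_distrib_left[symmetric] h(2) mult.left_commute)
      finally show "\<exists>h\<in>S. (\<Sum>b\<in>F. s b * (b \<cdot> Q)) = a * (Q * h)" using h(1) by blast
    qed
    then obtain h where h: "h \<in> S" "s i = a * h" by blast
    \<comment> \<open>The exponent of \<open>i\<close> in \<open>I\<close> is invertible in
      characteristic zero.\<close>
    define k where "k = (\<lambda>v::'v. inverse (of_nat (Suc (count J i))) :: 'k)"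
    have "k * of_nat (Suc (count J i)) = 1"
      unfolding k_def of_nat_eq_const const_mult one_fun_def by (simp del: of_nat_Suc)
    then have "c I = k * s i" unfolding s_def I by (simp only: mult.assoc[symmetric] mult_1)
    also have "\<dots> = a * (k * h)" by (simp only: h(2) mult.left_commute)
    finally show ?thesis using h(1) S_const unfolding k_def by blast
  qed
qed

subsection \<open>Generation\<close>

abbreviation "G \<equiv> generated_algebra scale (M ` S \<union> L)"

lemma G_M: "f \<in> S \<Longrightarrow> M f \<in> G"
  by (rule generated_algebra.generator) auto

lemma G_sum: "(\<And>i. i \<in> A \<Longrightarrow> h i \<in> G) \<Longrightarrow> sum h A \<in> G"
  using G_M[of 0] by (induction A rule: infinite_finite_induct) (auto intro: generated_algebra.add)

lemma G_word_op: "set w \<subseteq> B \<Longrightarrow> word_op w \<in> G"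
  by (induction w) (auto intro!: generated_algebra.comp G_M intro: generated_algebra.generator B_L)

lemma G_subset_T: "u \<in> G \<Longrightarrow> u \<in> T"
proof (induction rule: generated_algebra.induct)
  case (scalar c)
  then show ?case by (rule T_M[OF S_const])
next
  case (generator u)
  then show ?case using T_M L_subset_T by blast
qed (auto intro: T_add T_comp)

text \<open>The leading coefficients of \<open>a u\<close>, divided by \<open>a\<close>, define an
  element \<open>w\<close> of \<open>G\<close> such that \<open>a w\<close> and \<open>a u\<close>
  agree modulo shorter words. Since \<open>w\<close> is tangent as well, induction applies to
  \<open>u - w\<close>.\<close>

lemma word_span_quotient_in_G:
  assumes "a \<in> S" "a \<noteq> 0"
  shows "u \<in> T \<Longrightarrow> M a \<circ> u \<in> word_span p \<Longrightarrow> u \<in> G"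
proof (induction p arbitrary: u)
  case 0
  then have "M a \<circ> u = M a \<circ> 0" using assms by (simp add: word_span_0)
  then have "u = 0" by (rule M_cancel[OF assms T_E[OF 0(1)] E_0])
  then show ?case using G_M[of 0] by simp
next
  case (Suc p)
  obtain c where c: "leading_coeffs p (M a \<circ> u) c" using leading_coeffs_exist[OF Suc.prems(2)] by blast
  have "\<forall>I. \<exists>h. h \<in> S \<and> c I = a * h"
    using leading_coeffs_divisible[OF c refl Suc.prems(1) assms] by blast
  from choice[OF this] obtain h where h: "\<And>I. h I \<in> S" "\<And>I. c I = a * h I" by blast
  define K where "K = {I. c I \<noteq> 0}"
  define w where "w = (\<Sum>I\<in>K. M (h I) \<circ> monomial_op I)"
  have "monomial_op I \<in> G" if "I \<in> K" for I
  proof -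
    obtain x where x: "mset x = I" "monomial_op I = word_op x" using monomial_op_eq_word_op by blast
    moreover have "set_mset I \<subseteq> B" using that c by (auto simp: K_def leading_coeffs_def)
    ultimately show ?thesis using G_word_op[of x] by auto
  qed
  then have wG: "w \<in> G"
    unfolding w_def using h(1) by (intro G_sum generated_algebra.comp G_M) auto
  have monE: "monomial_op I \<in> E" if "I \<in> K" for I using that c by (auto simp: K_def leading_coeffs_def)
  have "M a \<circ> w = (\<Sum>I\<in>K. M a \<circ> (M (h I) \<circ> monomial_op I))"
    unfolding w_def using h(1) monE assms by (intro comp_sum_right) auto
  also have "\<dots> = (\<Sum>I\<in>K. M (c I) \<circ> monomial_op I)"
    using assms h by (intro sum.cong) (auto simp: M_comp')
  finally have "M a \<circ> (u - w) = (M a \<circ> u) - (\<Sum>I\<in>K. M (c I) \<circ> monomial_op I)"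
    using assms T_E[OF Suc.prems(1)] T_E[OF G_subset_T[OF wG]] by (simp add: comp_diff_right)
  also have "\<dots> \<in> word_span p" using c by (simp add: leading_coeffs_def K_def)
  finally have "u - w \<in> G"
    using Suc.IH T_diff[OF Suc.prems(1) G_subset_T[OF wG]] by blast
  then have "(u - w) + w \<in> G" using wG by (rule generated_algebra.add)
  then show ?case by simp
qed

theorem generated_algebra_eq_tangent_diff_ops: "G = T"
proof (intro set_eqI iffI)
  fix u assume u: "u \<in> T"
  then obtain p where "u \<in> ord_less p" using T_diff_ops diff_ops_iff by blast
  then obtain n q where "M (Q ^ n) \<circ> u \<in> word_span q" using ord_less_clear_denominators by blast
  then show "u \<in> G"
    using word_span_quotient_in_G[OF S_power[OF Q_S] S_power_nonzero[OF Q_S Q_nonzero] u] by blast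
qed (rule G_subset_T)

end

section \<open>Application to free arrangements\<close>

theorem theorem9:
  fixes scale :: "'k::field_char_0 \<Rightarrow> 'v::ab_group_add \<Rightarrow> 'v"
    and Basis :: "'v set"
    and \<A> :: "'v set set"
    and Q :: "'v \<Rightarrow> 'k"
  assumes "finite_dimensional_vector_space scale Basis"
    and "0 < vector_space.dim scale (UNIV :: 'v set)"
    and "central_arrangement scale \<A>"
    and "defining_polynomial scale \<A> Q"
    and "free_arrangement scale \<A>"
  shows "generated_algebra scale
      (mult_op scale ` poly_functions scale \<union> tangent_derivations scale Q)
    = tangent_diff_ops scale Q"
proof -
  interpret polynomial_operators scale Basis
    using assms(1) by (rule polynomial_operators.intro)
  \<comment> \<open>The freeness hypothesis supplies its own defining polynomial, which may differ
    from \<open>Q\<close>.\<close>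
  obtain Q' B where "defining_polynomial scale \<A> Q'" "poly_basis scale (tangent_derivations scale Q') B"
    using assms(5) unfolding free_arrangement_def free_graded_def by blast
  then have "poly_basis scale (tangent_derivations scale Q) B"
    using tangent_derivations_cong[OF assms(4)] by simp
  then interpret free_divisor scale Basis Q B
    using defining_polynomial_S[OF assms(4)] defining_polynomial_nonzero[OF assms(3,4)]
    by unfold_locales
  show ?thesis by (rule generated_algebra_eq_tangent_diff_ops)
qed

end
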